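(* Let $n\in\mathbb{N}$, $n\ge 3$. Let $\mathcal{D}=\{\alpha_1,\ldots,\alpha_m\}$ be a dissection of a convex $n$-gon $P_n$ of type $\{d_1,\ldots,d_m\}$ (where $\alpha_l$ has degree $d_l$), and let $M_{\mathcal{D}}=(m_{ij})_{1\le i,j\le n}$ be the matrix whose entry $m_{ij}$ is the number of walks from vertex $i$ to vertex $j$ around $P_n$. Then the matrix $M_{\mathcal{D}}$ is symmetric, with determinant $$\det M_{\mathcal{D}}=(-1)^{n-1}\prod_{j=1}^m (d_j-1).$$ Furthermore, there are matrices $U,V\in \mathrm{GL}(n,\mathbb{Z})$ with $$U M_{\mathcal{D}} V=\Delta(d_1-1,\ldots,d_m-1,1,\ldots,1).$$
   Context: $P_n$ is a convex $n$-gon ($n\ge3$) with vertices labelled $1,2,\ldots,n$ in counterclockwise order, labels being taken modulo $n$. A dissection $\mathcal{D}$ of $P_n$ is obtained by drawing $m-1$ ($m\ge 1$) pairwise noncrossing diagonals, which cut $P_n$ into $m$ polygons $\alpha_1,\ldots,\alpha_m$, called the pieces of the dissection; one writes $\mathcal{D}=\{\alpha_1,\ldots,\alpha_m\}$. If $\alpha_l$ has $d_l$ vertices, it is called a piece of degree $d_l$; the multiset $\{d_1,\ldots,d_m\}$ is the type of $\mathcal{D}$. For vertices $i,j$, a (counterclockwise) walk from $i$ to $j$ around $P_n$ is a sequence $w=(p_{i+1},p_{i+2},\ldots,p_{j-1})$ of pieces of $\mathcal{D}$, indexed by the vertices strictly between $i$ and $j$ when going counterclockwise from $i$ to $j$ (labels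 modulo $n$), such that: (i) $p_k$ is incident to vertex $k$ (i.e. $k$ is a vertex of $p_k$) for all $k\in\{i+1,\ldots,j-1\}$; (ii) each piece $\alpha\in\mathcal{D}$ of degree $d$ appears at most $d-2$ times among $p_{i+1},\ldots,p_{j-1}$. By convention, for $i=j$ there is no walk from $i$ to $i$; for $j=i+1$ (modulo $n$) the empty sequence is the unique walk from $i$ to $i+1$. $\Delta(a_1,\ldots,a_n)$ denotes the diagonal matrix with diagonal entries $a_1,\ldots,a_n$. *)

theory Defs
  imports "Jordan_Normal_Form.Determinant"
begin

(* The vertices of the convex n-gon, in counterclockwise order, are 0, ..., n - 1: labels are
   residues modulo n, and the vertex 0 is the one usually called n. The segment joining the
   vertices a < b is the pair (a, b). *)

definition diagonal :: "nat \<Rightarrow> nat \<times> nat \<Rightarrow> bool" where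
  "diagonal n = (\<lambda>(a, b). a < b \<and> b < n \<and> b \<noteq> a + 1 \<and> \<not> (a = 0 \<and> b = n - 1))"

definition crossing :: "nat \<times> nat \<Rightarrow> nat \<times> nat \<Rightarrow> bool" where
  "crossing = (\<lambda>(a, b) (c, d). (a < c \<and> c < b \<and> b < d) \<or> (c < a \<and> a < d \<and> d < b))"

definition noncrossing_diagonals :: "nat \<Rightarrow> (nat \<times> nat) set \<Rightarrow> bool" where
  "noncrossing_diagonals n T \<longleftrightarrow>
     (\<forall>e\<in>T. diagonal n e) \<and> (\<forall>e\<in>T. \<forall>f\<in>T. \<not> crossing e f)"

(* The vertices in each of the two closed half-planes bounded by the line through a and b. *)

definition sides :: "nat \<Rightarrow> nat \<times> nat \<Rightarrow> nat set set" where
  "sides n = (\<lambda>(a, b). {{a..b}, {..a} \<union> {b..<n}})"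

(* A piece is represented by its set of vertices. The regions into which T cuts the polygon are
   the intersections of the polygon with one closed side h e of each diagonal e in T, as far as
   these have nonempty interior. Since the diagonals do not cross, such a region is the convex
   hull of the vertices of the polygon that it contains; as these are in convex position, the
   interior is nonempty iff there are at least three of them. *)

definition pieces :: "nat \<Rightarrow> (nat \<times> nat) set \<Rightarrow> nat set set" where
  "pieces n T =
     {S. 3 \<le> card S \<and> (\<exists>h. (\<forall>e\<in>T. h e \<in> sides n e) \<and> S = {..<n} \<inter> (\<Inter>e\<in>T. h e))}"

(* The list w = [p(i+1), ..., p(j-1)] has (j - i - 1) mod n entries, and its entry number k
   belongs to the vertex i + 1 + k modulo n. The summand n avoids truncated subtraction. *)

definition is_walk :: "nat \<Rightarrow> nat set set \<Rightarrow> nat \<Rightarrow> nat \<Rightarrow> nat set list \<Rightarrow> bool" where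
  "is_walk n D i j w \<longleftrightarrow>
     i \<noteq> j \<and> length w = (j + n - i - 1) mod n \<and> set w \<subseteq> D \<and>
     (\<forall>k < length w. (i + 1 + k) mod n \<in> w ! k) \<and>
     (\<forall>\<alpha>\<in>D. count_list w \<alpha> \<le> card \<alpha> - 2)"

definition walk_matrix :: "nat \<Rightarrow> nat set set \<Rightarrow> int mat" where
  "walk_matrix n D = mat n n (\<lambda>(i, j). int (card {w. is_walk n D i j w}))"

definition GL_int :: "nat \<Rightarrow> int mat set" where
  "GL_int n = {U \<in> carrier_mat n n. invertible_mat U}"

end

theory Submission
  imports Defs
begin

text \<open>
Cut off an ear \<open>\<alpha>\<close> of degree \<open>k + 2\<close>, glued to the remaining polygon along \<open>ab\<close>, where
\<open>a\<close> and \<open>b\<close> are adjacent in that polygon. The vertices of \<open>\<alpha>\<close> other than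
\<open>a\<close> and \<open>b\<close> meet no other piece, so a walk through all \<open>k\<close> of them uses \<open>\<alpha>\<close> up, and a walk
starting or ending at one of them may use \<open>\<alpha>\<close> at most once more, at \<open>a\<close> or at \<open>b\<close>. Hence,
if \<open>M'\<close> belongs to the remaining polygon, the matrix is
\<open>[M', M' E\<^sup>T; E M', J - I]\<close>, where all \<open>k\<close> rows of \<open>E\<close> are equal to \<open>e\<^sub>a + e\<^sub>b\<close> and \<open>J\<close> is the all-ones
matrix. As \<open>E M' E\<^sup>T = 2 J\<close>, clearing the off-diagonal blocks leaves \<open>M'\<close> and \<open>- (I + J)\<close>, and
\<open>I + J\<close> has Smith form \<open>diag(k + 1, 1, \<dots>, 1)\<close> with \<open>k + 1 = deg \<alpha> - 1\<close>. The induction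
starts from a single segment, regarded as a 2-gon with no pieces.
\<close>

section \<open>Assignments of pieces to points\<close>

text \<open>A walk read as a function on the vertices it passes. Forgetting their order allows
  arbitrary sets of vertices to be taken away. Extensionality makes functions agreeing on
  \<open>X\<close> equal; the empty walk becomes the single assignment on the empty set.\<close>

definition assignments :: "'a set set \<Rightarrow> 'a set \<Rightarrow> ('a \<Rightarrow> 'a set) set" where
  "assignments D X = {p \<in> X \<rightarrow>\<^sub>E D. (\<forall>k\<in>X. k \<in> p k) \<and>
     (\<forall>\<alpha>\<in>D. card {k \<in> X. p k = \<alpha>} \<le> card \<alpha> - 2)}"

definition nassign :: "'a set set \<Rightarrow> 'a set \<Rightarrow> nat" where
  "nassign D X = card (assignments D X)"

lemma finite_assignments: "finite D \<Longrightarrow> finite X \<Longrightarrow> finite (assignments D X)"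
  unfolding assignments_def by (rule finite_subset[OF _ finite_PiE[of X "\<lambda>_. D"]]) auto

lemma nassign_empty_points [simp]: "nassign D {} = 1"
proof -
  have "assignments D {} = {\<lambda>_. undefined}" by (auto simp: assignments_def)
  thus ?thesis by (simp add: nassign_def)
qed

lemma nassign_not_covered: "\<not> X \<subseteq> \<Union>D \<Longrightarrow> nassign D X = 0"
proof -
  assume "\<not> X \<subseteq> \<Union>D"
  hence "assignments D X = {}" by (auto simp: assignments_def)
  thus ?thesis by (simp add: nassign_def)
qed

text \<open>Pigeonhole: every point uses up one unit of the capacity
  \<open>card \<alpha> - 2\<close> of some piece.\<close>

lemma nassign_too_many:
  assumes "finite D" "finite X" and big: "(\<Sum>\<alpha>\<in>D. card \<alpha> - 2) < card X"
  shows "nassign D X = 0"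
proof -
  have False if p: "p \<in> assignments D X" for p
  proof -
    have "card X = card (\<Union>\<alpha>\<in>D. {k \<in> X. p k = \<alpha>})"
      using p by (intro arg_cong[of _ _ card]) (auto simp: assignments_def)
    also have "\<dots> \<le> (\<Sum>\<alpha>\<in>D. card {k \<in> X. p k = \<alpha>})"
      by (rule card_UN_le[OF assms(1)])
    also have "\<dots> \<le> (\<Sum>\<alpha>\<in>D. card \<alpha> - 2)"
      using p by (intro sum_mono) (auto simp: assignments_def)
    finally show False using big by simp
  qed
  hence "assignments D X = {}" by blast
  thus ?thesis by (simp add: nassign_def)
qed

text \<open>Assignments are sorted by the set \<open>Y\<close> of points given to \<alpha>. As
  \<alpha> is not in \<open>D\<close>, the other capacities are untouched, so the rest is an
  arbitrary assignment of \<open>X - Y\<close>.\<close>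

lemma nassign_insert:
  assumes D: "finite D" and X: "finite X" and \<alpha>: "\<alpha> \<notin> D"
  shows "nassign (insert \<alpha> D) X =
    (\<Sum>Y\<in>{Y. Y \<subseteq> X \<inter> \<alpha> \<and> card Y \<le> card \<alpha> - 2}. nassign D (X - Y))"
proof -
  let ?I = "{Y. Y \<subseteq> X \<inter> \<alpha> \<and> card Y \<le> card \<alpha> - 2}"
  let ?F = "\<lambda>Y. {p \<in> assignments (insert \<alpha> D) X. {k \<in> X. p k = \<alpha>} = Y}"
  have fin: "finite ?I" by (rule finite_subset[of _ "Pow X"]) (use X in auto)
  have "assignments (insert \<alpha> D) X = (\<Union>Y\<in>?I. ?F Y)"
    by (auto simp: assignments_def)
  hence "nassign (insert \<alpha> D) X = card (\<Union>Y\<in>?I. ?F Y)" by (simp add: nassign_def)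
  also have "\<dots> = (\<Sum>Y\<in>?I. card (?F Y))"
    using fin finite_assignments[of "insert \<alpha> D" X] D X by (intro card_UN_disjoint) auto
  also have "\<dots> = (\<Sum>Y\<in>?I. nassign D (X - Y))"
  proof (rule sum.cong[OF refl])
    fix Y assume Y: "Y \<in> ?I"
    have "bij_betw (\<lambda>p. restrict p (X - Y)) (?F Y) (assignments D (X - Y))"
    proof (rule bij_betw_byWitness[where f' = "\<lambda>q k. if k \<in> Y then \<alpha> else q k"])
      show "\<forall>p\<in>?F Y. (\<lambda>k. if k \<in> Y then \<alpha> else restrict p (X - Y) k) = p"
        by (auto simp: assignments_def fun_eq_iff PiE_def extensional_def)
      show "\<forall>q\<in>assignments D (X - Y). restrict (\<lambda>k. if k \<in> Y then \<alpha> else q k) (X - Y) = q"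
        by (auto simp: assignments_def fun_eq_iff PiE_def extensional_def)
      show "(\<lambda>p. restrict p (X - Y)) ` ?F Y \<subseteq> assignments D (X - Y)"
      proof safe
        fix p assume p: "p \<in> assignments (insert \<alpha> D) X" and YY: "Y = {k \<in> X. p k = \<alpha>}"
        have "{k \<in> X - Y. restrict p (X - Y) k = \<beta>} = {k \<in> X. p k = \<beta>}" if "\<beta> \<in> D" for \<beta>
          using that \<alpha> YY by auto
        thus "restrict p (X - {k \<in> X. p k = \<alpha>}) \<in> assignments D (X - {k \<in> X. p k = \<alpha>})"
          using p YY by (auto simp: assignments_def)
      qed
      show "(\<lambda>q k. if k \<in> Y then \<alpha> else q k) ` assignments D (X - Y) \<subseteq> ?F Y"
      proof (rule image_subsetI)
        fix q assume q: "q \<in> assignments D (X - Y)"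
        let ?p = "\<lambda>k. if k \<in> Y then \<alpha> else q k"
        have qD: "q k \<in> D" if "k \<in> X" "k \<notin> Y" for k using q that by (auto simp: assignments_def)
        have pa: "{k \<in> X. ?p k = \<alpha>} = Y" using qD \<alpha> Y by auto
        have "{k \<in> X. ?p k = \<beta>} = {k \<in> X - Y. q k = \<beta>}" if "\<beta> \<in> D" for \<beta>
          using that \<alpha> by auto
        hence "\<forall>\<beta>\<in>D. card {k \<in> X. ?p k = \<beta>} \<le> card \<beta> - 2"
          using q by (auto simp: assignments_def)
        moreover have "card {k \<in> X. ?p k = \<alpha>} \<le> card \<alpha> - 2" using pa Y by simp
        moreover have "?p \<in> X \<rightarrow>\<^sub>E insert \<alpha> D"
          using q Y qD by (auto simp: assignments_def PiE_def extensional_def Pi_def)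
        moreover have "\<forall>k\<in>X. k \<in> ?p k" using q Y by (auto simp: assignments_def)
        ultimately have "?p \<in> assignments (insert \<alpha> D) X"
          unfolding assignments_def by blast
        thus "?p \<in> ?F Y" using pa by blast
      qed
    qed
    thus "card (?F Y) = nassign D (X - Y)" unfolding nassign_def by (rule bij_betw_same_card)
  qed
  finally show ?thesis .
qed

text \<open>No piece of \<open>D\<close> contains a point of \<open>A\<close>, so the new piece must
  serve all of \<open>X \<inter> A\<close>. Its capacity is \<open>card A\<close>; the only freedom
  is the set \<open>S\<close> of those among \<open>a\<close> and \<open>b\<close> that it serves as
  well.\<close>

lemma nassign_insert_ear:
  assumes D: "finite D" and X: "finite X" and A: "finite A" "A \<noteq> {}" "A \<inter> \<Union>D = {}"
    and ab: "a \<notin> A" "b \<notin> A" "a \<noteq> b"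
  shows "nassign (insert (insert a (insert b A)) D) X =
    (\<Sum>S\<in>{S. S \<subseteq> X \<inter> {a, b} \<and> card S + card (X \<inter> A) \<le> card A}. nassign D (X - A - S))"
proof -
  let ?\<alpha> = "insert a (insert b A)"
  let ?J = "{S. S \<subseteq> X \<inter> {a, b} \<and> card S + card (X \<inter> A) \<le> card A}"
  let ?I = "{Y. Y \<subseteq> X \<inter> ?\<alpha> \<and> card Y \<le> card ?\<alpha> - 2}"
  have \<alpha>: "?\<alpha> \<notin> D" using A by auto
  have card\<alpha>: "card ?\<alpha> - 2 = card A" using A ab by simp
  have finI: "finite ?I" by (rule finite_subset[of _ "Pow X"]) (use X in auto)
  have inj: "inj_on (\<lambda>S. S \<union> (X \<inter> A)) ?J"
    using ab by (intro inj_onI) blast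
  have cardU: "card (S \<union> (X \<inter> A)) = card S + card (X \<inter> A)" if "S \<subseteq> X \<inter> {a, b}" for S
    by (rule card_Un_disjoint) (use that ab A X in \<open>auto intro: finite_subset\<close>)
  have sub: "(\<lambda>S. S \<union> (X \<inter> A)) ` ?J \<subseteq> ?I"
    using cardU card\<alpha> by auto
  have "(\<Sum>S\<in>?J. nassign D (X - A - S)) = (\<Sum>S\<in>?J. nassign D (X - (S \<union> (X \<inter> A))))"
    by (intro sum.cong[OF refl] arg_cong[of _ _ "nassign D"]) auto
  also have "\<dots> = (\<Sum>Y\<in>(\<lambda>S. S \<union> (X \<inter> A)) ` ?J. nassign D (X - Y))"
    by (subst sum.reindex[OF inj]) simp
  \<comment> \<open>The sets \<open>Y\<close> outside the image miss a point of
    \<open>X \<inter> A\<close>, which nothing in \<open>D\<close> can serve.\<close>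
  also have "\<dots> = (\<Sum>Y\<in>?I. nassign D (X - Y))"
  proof (rule sum.mono_neutral_left[OF finI sub], rule ballI)
    fix Y assume Y: "Y \<in> ?I - (\<lambda>S. S \<union> (X \<inter> A)) ` ?J"
    have "\<not> X \<inter> A \<subseteq> Y"
    proof
      assume "X \<inter> A \<subseteq> Y"
      hence "Y = (Y - A) \<union> (X \<inter> A)" using Y by auto
      moreover have "Y - A \<subseteq> X \<inter> {a, b}" using Y by auto
      ultimately have "Y - A \<in> ?J" using cardU[of "Y - A"] Y card\<alpha> by auto
      thus False using Y \<open>Y = (Y - A) \<union> (X \<inter> A)\<close> by blast
    qed
    thus "nassign D (X - Y) = 0" using A by (intro nassign_not_covered) auto
  qed
  finally show ?thesis using nassign_insert[OF D X \<alpha>] by simp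
qed

section \<open>Walks around a polygon with an ear glued on\<close>

text \<open>
Ears are never glued to the edge from the last vertex to the first. This loses nothing, as the
chords can be removed in a suitable order, and it keeps the new labels between \<open>a\<close> and \<open>b\<close>.
\<close>

inductive dissected :: "nat set \<Rightarrow> nat set set \<Rightarrow> bool" where
  segment: "a < b \<Longrightarrow> dissected {a, b} {}"
| glue: "dissected V D \<Longrightarrow> a \<in> V \<Longrightarrow> b \<in> V \<Longrightarrow> a < b \<Longrightarrow> V \<inter> {a<..<b} = {} \<Longrightarrow>
    finite A \<Longrightarrow> A \<noteq> {} \<Longrightarrow> A \<subseteq> {a<..<b} \<Longrightarrow>
    dissected (V \<union> A) (insert (insert a (insert b A)) D)"

text \<open>Each gluing adds \<open>card A\<close> vertices and equally much capacity, so the total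
  capacity stays two below the number of vertices.\<close>

lemma dissected_facts:
  "dissected V D \<Longrightarrow> finite V \<and> finite D \<and> \<Union>D \<subseteq> V \<and> 2 \<le> card V \<and>
     (\<Sum>\<alpha>\<in>D. card \<alpha> - 2) + 2 = card V"
proof (induction rule: dissected.induct)
  case (glue V D a b A)
  have dj: "V \<inter> A = {}" using glue by auto
  have "a \<notin> A" "b \<notin> A" "a \<noteq> b" using glue.hyps by auto
  hence c: "card (insert a (insert b A)) - 2 = card A" using glue.hyps(6) by simp
  have n: "insert a (insert b A) \<notin> D" using glue.IH glue.hyps dj by blast
  show ?case using glue dj c n by (auto simp: card_Un_disjoint)
qed auto

text \<open>
For \<open>i = j\<close> the arc is \<open>V - {i}\<close>, which has one point more than the pieces can serve. This
gives the value 0 that the convention prescribes for walks from \<open>i\<close> to \<open>i\<close>.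
\<close>

definition arc :: "nat set \<Rightarrow> nat \<Rightarrow> nat \<Rightarrow> nat set" where
  "arc V i j = {k \<in> V. if i < j then i < k \<and> k < j else i < k \<or> k < j}"

lemma arc_subset: "arc V i j \<subseteq> V"
  by (auto simp: arc_def)

lemma nassign_full_arc:
  assumes "dissected V D" "V - {k} \<subseteq> X" "finite X"
  shows "nassign D X = 0"
proof (rule nassign_too_many)
  note f = dissected_facts[OF assms(1)]
  have "card V - 1 \<le> card (V - {k})" using f by (simp add: card_Diff_singleton_if)
  also have "\<dots> \<le> card X" by (rule card_mono) (use assms in auto)
  finally show "(\<Sum>\<alpha>\<in>D. card \<alpha> - 2) < card X" using f by linarith
qed (use assms dissected_facts[OF assms(1)] in auto)

lemma nassign_arc_same:
  assumes "dissected V D"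
  shows "nassign D (arc V i i) = 0"
  by (rule nassign_full_arc[OF assms, of i])
    (use dissected_facts[OF assms] in \<open>auto simp: arc_def\<close>)

section \<open>How gluing an ear changes the counts along arcs\<close>

locale ear =
  fixes V :: "nat set" and D a b A
  assumes dis: "dissected V D" and aV: "a \<in> V" and bV: "b \<in> V" and ab: "a < b"
    and gap: "V \<inter> {a<..<b} = {}" and A: "finite A" "A \<noteq> {}" "A \<subseteq> {a<..<b}"
begin

lemma disjoint: "V \<inter> A = {}"
  using gap A by blast

lemma outside: "i \<in> V \<Longrightarrow> i \<le> a \<or> b \<le> i"
  using gap by force

lemma inside: "k \<in> A \<Longrightarrow> a < k \<and> k < b"
  using A by auto

lemma dissected_glued: "dissected (V \<union> A) (insert (insert a (insert b A)) D)"
  using dissected.glue dis aV bV ab gap A by blast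

lemma nassign_arc_glued:
  "nassign (insert (insert a (insert b A)) D) (arc (V \<union> A) i j) =
    (\<Sum>S\<in>{S. S \<subseteq> arc (V \<union> A) i j \<inter> {a, b} \<and> card S + card (arc (V \<union> A) i j \<inter> A) \<le> card A}.
       nassign D (arc V i j - S))"
proof -
  note f = dissected_facts[OF dis]
  have "arc (V \<union> A) i j - A = arc V i j" using disjoint by (auto simp: arc_def)
  moreover have "finite (arc (V \<union> A) i j)"
    using f A by (intro finite_subset[OF arc_subset]) auto
  ultimately show ?thesis
    using f A disjoint ab inside
    by (subst nassign_insert_ear) auto
qed

lemma card_arc_le: "card (arc (V \<union> A) i j \<inter> A) \<le> card A"
  by (intro card_mono) (use A in auto)

text \<open>Old ends do not lie in \<open>A\<close>, so an arc through \<open>a\<close> or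
  \<open>b\<close> contains all of \<open>A\<close>. The ear is then exhausted, and
  \<open>S = {}\<close> is the only choice.\<close>

lemma glued_old_old:
  assumes i: "i \<in> V" and j: "j \<in> V"
  shows "nassign (insert (insert a (insert b A)) D) (arc (V \<union> A) i j) = nassign D (arc V i j)"
proof (cases "i = j")
  case True
  thus ?thesis using nassign_arc_same dis dissected_glued by simp
next
  case False
  let ?X = "arc (V \<union> A) i j"
  have AX: "k \<in> ?X" if X: "?X \<inter> {a, b} \<noteq> {}" and k: "k \<in> A" for k
  proof -
    have "a \<in> ?X \<or> b \<in> ?X" using X by auto
    thus ?thesis using False ab outside[OF i] outside[OF j] inside[OF k] k
      by (cases "i \<le> a"; cases "j \<le> a"; cases "i < j") (auto simp: arc_def)
  qed
  have full: "card (?X \<inter> A) = card A" if "?X \<inter> {a, b} \<noteq> {}"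
  proof -
    have "?X \<inter> A = A" using AX[OF that] by blast
    thus ?thesis by simp
  qed
  have "S = {}" if S: "S \<subseteq> ?X \<inter> {a, b}" "card S + card (?X \<inter> A) \<le> card A" for S
  proof (rule ccontr)
    assume ne: "S \<noteq> {}"
    hence "card (?X \<inter> A) = card A" using S(1) by (intro full) blast
    hence "card S = 0" using S(2) by simp
    moreover have "finite S" by (rule finite_subset[of _ "{a, b}"]) (use S(1) in auto)
    ultimately show False using ne by simp
  qed
  hence "{S. S \<subseteq> ?X \<inter> {a, b} \<and> card S + card (?X \<inter> A) \<le> card A} \<subseteq> {{}}" by blast
  moreover have "{} \<in> {S. S \<subseteq> ?X \<inter> {a, b} \<and> card S + card (?X \<inter> A) \<le> card A}"
    using card_arc_le[of i j] by simp
  ultimately have "{S. S \<subseteq> ?X \<inter> {a, b} \<and> card S + card (?X \<inter> A) \<le> card A} = {{}}" by blast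
  thus ?thesis unfolding nassign_arc_glued by simp
qed

text \<open>An end of the arc lying in \<open>A\<close> leaves the ear at least one spare
  use.\<close>

lemma card_arc_less: "k \<in> A \<Longrightarrow> k \<notin> arc (V \<union> A) i j \<Longrightarrow> card (arc (V \<union> A) i j \<inter> A) < card A"
  by (intro psubset_card_mono) (use A in auto)

lemma sum_two:
  assumes "arc (V \<union> A) i j \<inter> {a, b} = {c}" "card (arc (V \<union> A) i j \<inter> A) < card A"
  shows "nassign (insert (insert a (insert b A)) D) (arc (V \<union> A) i j) =
    nassign D (arc V i j) + nassign D (arc V i j - {c})"
proof -
  have "{S. S \<subseteq> {c} \<and> card S + card (arc (V \<union> A) i j \<inter> A) \<le> card A} = {{}, {c}}"
    using assms(2) by (auto simp: subset_singleton_iff)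
  thus ?thesis unfolding nassign_arc_glued assms(1) by simp
qed

lemma sum_one:
  assumes "arc (V \<union> A) i j \<inter> {a, b} = {}"
  shows "nassign (insert (insert a (insert b A)) D) (arc (V \<union> A) i j) = nassign D (arc V i j)"
proof -
  have *: "{S. S \<subseteq> {} \<and> card S + card (arc (V \<union> A) i j \<inter> A) \<le> card A} = {{}}"
    using card_arc_le[of i j] by auto
  thus ?thesis unfolding nassign_arc_glued assms * by simp
qed

lemma arc_gap: "arc V a b = {}"
  using gap ab by (auto simp: arc_def)

text \<open>Unless \<open>i = a\<close>, the walk passes \<open>a\<close> but not \<open>b\<close>.
  Either an old piece serves \<open>a\<close>, and what remains is the arc from \<open>i\<close> to
  \<open>b\<close>, or the ear does, and the arc from \<open>i\<close> to \<open>a\<close> remains.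
  For \<open>i = a\<close> the sum is 0 + 1.\<close>

lemma glued_old_new:
  assumes i: "i \<in> V" and j: "j \<in> A"
  shows "nassign (insert (insert a (insert b A)) D) (arc (V \<union> A) i j) =
    nassign D (arc V i a) + nassign D (arc V i b)"
proof (cases "i = a")
  case True
  have "arc (V \<union> A) i j \<inter> {a, b} = {}"
    using True inside[OF j] ab by (simp add: arc_def)
  moreover have "arc V i j \<subseteq> arc V a b"
    using True inside[OF j] ab by (auto simp: arc_def)
  ultimately show ?thesis using True by (simp add: sum_one arc_gap nassign_arc_same[OF dis])
next
  case False
  have x1: "arc (V \<union> A) i j \<inter> {a, b} = {a}"
    using False inside[OF j] ab outside[OF i] aV by (auto simp: arc_def)
  have x2: "arc V i j = arc V i b"
  proof -
    have "k \<in> arc V i j \<longleftrightarrow> k \<in> arc V i b" for k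
      using False inside[OF j] outside[of k] outside[OF i] ab aV bV by (cases "i \<le> a"; cases "k \<in> V") (auto simp: arc_def)
    thus ?thesis by blast
  qed
  have x3: "arc V i b - {a} = arc V i a"
  proof -
    have "k \<in> arc V i b - {a} \<longleftrightarrow> k \<in> arc V i a" for k
      using False inside[OF j] outside[of k] outside[OF i] ab aV bV by (cases "i \<le> a"; cases "k \<in> V") (auto simp: arc_def)
    thus ?thesis by blast
  qed
  have x4: "j \<notin> arc (V \<union> A) i j" by (simp add: arc_def)
  show ?thesis using sum_two[OF x1 card_arc_less[OF j x4]] unfolding x2 x3 by linarith
qed

text \<open>The mirror image: here \<open>b\<close> is the vertex that may be served by the
  ear.\<close>

lemma glued_new_old:
  assumes i: "i \<in> A" and j: "j \<in> V"
  shows "nassign (insert (insert a (insert b A)) D) (arc (V \<union> A) i j) =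
    nassign D (arc V a j) + nassign D (arc V b j)"
proof (cases "j = b")
  case True
  have "arc (V \<union> A) i j \<inter> {a, b} = {}"
    using True inside[OF i] ab by (simp add: arc_def)
  moreover have "arc V i j \<subseteq> arc V a b"
    using True inside[OF i] ab by (auto simp: arc_def)
  ultimately show ?thesis using True by (simp add: sum_one arc_gap nassign_arc_same[OF dis])
next
  case False
  have x1: "arc (V \<union> A) i j \<inter> {a, b} = {b}"
    using False inside[OF i] ab outside[OF j] bV by (auto simp: arc_def)
  have x2: "arc V i j = arc V a j"
  proof -
    have "k \<in> arc V i j \<longleftrightarrow> k \<in> arc V a j" for k
      using False inside[OF i] outside[of k] outside[OF j] ab aV bV by (cases "j \<le> a"; cases "k \<in> V") (auto simp: arc_def)
    thus ?thesis by blast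
  qed
  have x3: "arc V a j - {b} = arc V b j"
  proof -
    have "k \<in> arc V a j - {b} \<longleftrightarrow> k \<in> arc V b j" for k
      using False inside[OF i] outside[of k] outside[OF j] ab aV bV by (cases "j \<le> a"; cases "k \<in> V") (auto simp: arc_def)
    thus ?thesis by blast
  qed
  have x4: "i \<notin> arc (V \<union> A) i j" by (simp add: arc_def)
  show ?thesis using sum_two[OF x1 card_arc_less[OF i x4]] unfolding x2 x3 by linarith
qed

text \<open>For \<open>i < j\<close> only the ear is available. Otherwise the arc passes all of
  \<open>V\<close>, and the ear has two spare uses because \<open>i\<close> and \<open>j\<close> are
  both missing; it must spend them on \<open>a\<close> and \<open>b\<close>. The value for the arc
  from \<open>b\<close> to \<open>a\<close> is a premise because the proof of symmetry, which yields
  it, relies on this lemma.\<close>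

lemma glued_new_new:
  assumes i: "i \<in> A" and j: "j \<in> A" and ne: "i \<noteq> j" and ba: "nassign D (arc V b a) = 1"
  shows "nassign (insert (insert a (insert b A)) D) (arc (V \<union> A) i j) = 1"
proof (cases "i < j")
  case True
  have "arc (V \<union> A) i j \<inter> {a, b} = {}"
    using True inside[OF i] inside[OF j] by (simp add: arc_def)
  moreover have "arc V i j \<subseteq> arc V a b"
    using True inside[OF i] inside[OF j] ab by (auto simp: arc_def)
  ultimately show ?thesis using sum_one[of i j] arc_gap by simp
next
  case False
  let ?X = "arc (V \<union> A) i j"
  have Xab: "?X \<inter> {a, b} = {a, b}"
    using False inside[OF i] inside[OF j] aV bV by (auto simp: arc_def)
  have XV: "arc V i j = V"
  proof -
    have "k \<in> arc V i j \<longleftrightarrow> k \<in> V" for k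
      using False inside[OF i] inside[OF j] outside[of k] by (cases "k \<in> V") (auto simp: arc_def)
    thus ?thesis by blast
  qed
  have "?X \<inter> A \<subseteq> A - {i, j}" using False ne by (auto simp: arc_def)
  hence "card (?X \<inter> A) \<le> card (A - {i, j})" by (intro card_mono) (use A in auto)
  moreover have "card (A - {i, j}) + 2 = card A"
    using card_Diff_subset[of "{i, j}" A] card_mono[of A "{i, j}"] A i j ne by simp
  ultimately have le: "card (?X \<inter> A) + 2 \<le> card A" by linarith
  have "card S + card (?X \<inter> A) \<le> card A" if "S \<subseteq> {a, b}" for S
    using card_mono[of "{a, b}" S] that ab le by simp
  hence "{S. S \<subseteq> {a, b} \<and> card S + card (?X \<inter> A) \<le> card A} = Pow {a, b}" by blast
  also have "Pow {a, b} = {{}, {a}, {b}, {a, b}}" by (simp add: Pow_insert) blast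
  finally have "{S. S \<subseteq> {a, b} \<and> card S + card (?X \<inter> A) \<le> card A} = {{}, {a}, {b}, {a, b}}" .
  hence "nassign (insert (insert a (insert b A)) D) ?X =
    (\<Sum>S\<in>{{}, {a}, {b}, {a, b}}. nassign D (V - S))"
    unfolding nassign_arc_glued Xab XV by simp
  also have "\<dots> = nassign D V + nassign D (V - {a}) + nassign D (V - {b}) + nassign D (V - {a, b})"
    using ab by (simp add: insert_eq_iff doubleton_eq_iff)
  \<comment> \<open>Unless both \<open>a\<close> and \<open>b\<close> go to the ear, the old pieces
    face at least \<open>card V - 1\<close> points, one more than they can serve.\<close>
  also have "nassign D V = 0"
    by (rule nassign_full_arc[OF dis, of a]) (use dissected_facts[OF dis] in auto)
  also have "nassign D (V - {a}) = 0"
    by (rule nassign_full_arc[OF dis, of a]) (use dissected_facts[OF dis] in auto)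
  also have "nassign D (V - {b}) = 0"
    by (rule nassign_full_arc[OF dis, of b]) (use dissected_facts[OF dis] in auto)
  also have "V - {a, b} = arc V b a"
  proof -
    have "k \<in> V - {a, b} \<longleftrightarrow> k \<in> arc V b a" for k
      using outside[of k] ab aV bV by (cases "k \<in> V") (auto simp: arc_def)
    thus ?thesis by blast
  qed
  finally show ?thesis using ba by simp
qed

end

text \<open>Exchanging the ends turns the formulas for the glued polygon into one another, given
  symmetry before gluing. The induction hypothesis also gives the value 1 from \<open>b\<close> to
  \<open>a\<close>, the arc from \<open>a\<close> to \<open>b\<close> being empty.\<close>

lemma nassign_arc_sym:
  assumes "dissected V D" "i \<in> V" "j \<in> V"
  shows "nassign D (arc V i j) = nassign D (arc V j i)"
  using assms
proof (induction arbitrary: i j rule: dissected.induct)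
  case (segment a b)
  have "arc {a, b} a b = {}" "arc {a, b} b a = {}" using segment by (auto simp: arc_def)
  thus ?case using segment by auto
next
  case (glue V D a b A)
  interpret ear V D a b A by unfold_locales (use glue in auto)
  have "nassign D (arc V b a) = 1" using glue.IH[of b a] glue.hyps arc_gap by simp
  note nn = glued_new_new[OF _ _ _ this]
  show ?case
    using glue.prems glue.IH glued_old_old glued_old_new glued_new_old nn aV bV
    by (cases "i = j") auto
qed

lemma (in ear) nassign_arc_gap: "nassign D (arc V b a) = 1"
  using nassign_arc_sym[OF dis bV aV] arc_gap by simp

section \<open>Pieces and lists of pieces\<close>

text \<open>Cutting off ears leaves vertex sets with gaps in their labels. The half-planes keep
  referring to the original polygon, so only \<open>V\<close> and \<open>T\<close> change.\<close>

definition subpieces :: "nat \<Rightarrow> nat set \<Rightarrow> (nat \<times> nat) set \<Rightarrow> nat set set" where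
  "subpieces n V T =
     {S. 3 \<le> card S \<and> (\<exists>h. (\<forall>e\<in>T. h e \<in> sides n e) \<and> S = V \<inter> (\<Inter>e\<in>T. h e))}"

lemma pieces_eq_subpieces: "pieces n T = subpieces n {..<n} T"
  by (simp add: pieces_def subpieces_def)

text \<open>Being a diagonal is expressed by vertices of \<open>V\<close> strictly on both sides,
  since in a set with gaps neighbouring labels no longer describe adjacency.\<close>

definition chords :: "nat set \<Rightarrow> (nat \<times> nat) set \<Rightarrow> bool" where
  "chords V T \<longleftrightarrow> (\<forall>(a, b)\<in>T. a \<in> V \<and> b \<in> V \<and> a < b \<and>
     (\<exists>x\<in>V. a < x \<and> x < b) \<and> (\<exists>x\<in>V. x < a \<or> b < x)) \<and> (\<forall>e\<in>T. \<forall>f\<in>T. \<not> crossing e f)"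

lemma chords_of_noncrossing:
  assumes "noncrossing_diagonals n T"
  shows "chords {..<n} T"
proof -
  have ex: "\<exists>x\<in>{..<n}. a < x \<and> x < b" "\<exists>x\<in>{..<n}. x < a \<or> b < x" if "diagonal n (a, b)" for a b
  proof -
    show "\<exists>x\<in>{..<n}. a < x \<and> x < b"
      by (rule bexI[of _ "a + 1"]) (use that in \<open>auto simp: diagonal_def\<close>)
    show "\<exists>x\<in>{..<n}. x < a \<or> b < x"
      by (rule bexI[of _ "if a = 0 then n - 1 else 0"]) (use that in \<open>auto simp: diagonal_def\<close>)
  qed
  show ?thesis
    unfolding chords_def
  proof (intro conjI ballI, clarify)
    fix a b assume "(a, b) \<in> T"
    hence d: "diagonal n (a, b)" using assms by (simp add: noncrossing_diagonals_def)
    hence "a < b" "b < n" by (auto simp: diagonal_def)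
    thus "a \<in> {..<n} \<and> b \<in> {..<n} \<and> a < b \<and> (\<exists>x\<in>{..<n}. a < x \<and> x < b) \<and> (\<exists>x\<in>{..<n}. x < a \<or> b < x)"
      using ex[OF d] by simp
  qed (use assms in \<open>simp add: noncrossing_diagonals_def\<close>)
qed

text \<open>An undissected polygon is one ear, glued to the segment from its least to its greatest
  vertex.\<close>

lemma dissected_polygon:
  assumes V: "finite V" "3 \<le> card V"
  shows "dissected V {V}"
proof -
  let ?a = "Min V" and ?b = "Max V"
  let ?A = "V - {?a, ?b}"
  have ne: "V \<noteq> {}" using V by auto
  have mem: "?a \<in> V" "?b \<in> V" using V ne by auto
  have cA: "card ?A + 2 \<ge> 3"
    using V diff_card_le_card_Diff[of "{?a, ?b}" V] card_insert_if[of "{?b}" ?a] by (auto split: if_splits)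
  have Ane: "?A \<noteq> {}"
  proof
    assume e: "?A = {}"
    show False using cA unfolding e by simp
  qed
  have "?a \<le> x \<and> x \<le> ?b" if "x \<in> V" for x using V that by auto
  hence sub: "?A \<subseteq> {?a<..<?b}" by (force simp: le_less)
  hence ab: "?a < ?b" using Ane by fastforce
  have "dissected ({?a, ?b} \<union> ?A) (insert (insert ?a (insert ?b ?A)) {})"
    by (rule dissected.glue[OF dissected.segment[OF ab]]) (use V ab sub Ane in auto)
  moreover have "{?a, ?b} \<union> ?A = V" "insert ?a (insert ?b ?A) = V" using mem by auto
  ultimately show ?thesis by simp
qed

text \<open>A chord \<open>ab\<close> with \<open>b - a\<close> minimal cuts off an ear, as no other chord ends strictly between \<open>a\<close> and \<open>b\<close>.\<close>

lemma dissected_subpieces: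
  assumes "finite T" "chords V T" "V \<subseteq> {..<n}" "3 \<le> card V"
  shows "dissected V (subpieces n V T)"
  using assms
proof (induction "card T" arbitrary: V T)
  case 0
  hence "subpieces n V T = {V}" by (auto simp: subpieces_def)
  thus ?case using 0 dissected_polygon[of V] finite_subset[of V "{..<n}"] by simp
next
  case (Suc k)
  have fV: "finite V" using Suc.prems finite_subset by blast
  have "T \<noteq> {}" using Suc.hyps by auto
  then obtain e where "is_arg_min (\<lambda>f. snd f - fst f) (\<lambda>f. f \<in> T) e"
    using ex_is_arg_min_if_finite[OF Suc.prems(1)] by blast
  then obtain a b where e: "(a, b) \<in> T" and le: "\<forall>c d. (c, d) \<in> T \<longrightarrow> b - a \<le> d - c"
    unfolding is_arg_min_linorder by (cases e) force
  have min: "b - a \<le> d - c" if "(c, d) \<in> T" for c d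
    using le that by blast
  have chord: "c \<in> V" "d \<in> V" "c < d" "\<exists>x\<in>V. c < x \<and> x < d" "\<exists>x\<in>V. x < c \<or> d < x"
    if "(c, d) \<in> T" for c d using that Suc.prems(2) unfolding chords_def by blast+
  have cross: "\<not> crossing e f" if "e \<in> T" "f \<in> T" for e f
    using that Suc.prems(2) unfolding chords_def by blast
  note ab = chord[OF e]
  define A where "A = V \<inter> {a<..<b}"
  define V' where "V' = V - A"
  define T' where "T' = T - {(a, b)}"
  have T: "T = insert (a, b) T'" using e by (auto simp: T'_def)
  \<comment> \<open>A chord with an end strictly between \<open>a\<close> and \<open>b\<close>
    would, by noncrossing, be nested inside \<open>ab\<close> and hence be shorter.\<close>
  have out: "(c \<le> a \<or> b \<le> c) \<and> (d \<le> a \<or> b \<le> d)" if "(c, d) \<in> T" for c d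
    using min[OF that] cross[OF e that] chord(3)[OF that] ab(3) by (auto simp: crossing_def)
  have A: "finite A" "A \<noteq> {}" "A \<subseteq> {a<..<b}" using fV ab(4) by (auto simp: A_def)
  have VV': "V = V' \<union> A" by (auto simp: V'_def A_def)
  have aV': "a \<in> V'" "b \<in> V'" using ab by (auto simp: V'_def A_def)
  have gap: "V' \<inter> {a<..<b} = {}" by (auto simp: V'_def A_def)
  have V'_iff: "x \<in> V' \<longleftrightarrow> x \<in> V \<and> (x \<le> a \<or> b \<le> x)" for x by (auto simp: V'_def A_def)
  have "chords V' T'"
    unfolding chords_def
  proof (intro conjI ballI, clarify)
    fix c d assume "(c, d) \<in> T'"
    hence cd: "(c, d) \<in> T" and ne: "c \<noteq> a \<or> d \<noteq> b" by (auto simp: T'_def)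
    note C = chord[OF cd] and O = out[OF cd]
    \<comment> \<open>A witness lying in \<open>A\<close> is lost with the ear. It is replaced by
      \<open>a\<close> or \<open>b\<close>, because \<open>cd\<close> has no end strictly inside
      \<open>ab\<close> and differs from \<open>ab\<close>.\<close>
    obtain x y where x: "x \<in> V" "c < x" "x < d" and y: "y \<in> V" "y < c \<or> d < y" using C by blast
    have "\<exists>x\<in>V'. c < x \<and> x < d"
    proof (cases "x \<in> V'")
      case False
      hence "a < x" "x < b" using x V'_iff by auto
      hence "c < a \<or> c = a" "b < d \<or> d = b" using O x by auto
      thus ?thesis using ne ab aV' by auto
    qed (use x in auto)
    moreover have "\<exists>x\<in>V'. x < c \<or> d < x"
    proof (cases "y \<in> V'")
      case False
      hence "a < y" "y < b" using y V'_iff by auto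
      hence "a < c \<or> d < b" using O y by auto
      thus ?thesis using aV' by auto
    qed (use y in auto)
    ultimately show "c \<in> V' \<and> d \<in> V' \<and> c < d \<and> (\<exists>x\<in>V'. c < x \<and> x < d) \<and> (\<exists>x\<in>V'. x < c \<or> d < x)"
      using C O V'_iff by auto
  qed (use cross in \<open>auto simp: T'_def\<close>)
  \<comment> \<open>The chord \<open>ab\<close> has a vertex on its far side, which survives
    together with \<open>a\<close> and \<open>b\<close>.\<close>
  moreover have "3 \<le> card V'"
  proof -
    obtain x where x: "x \<in> V" "x < a \<or> b < x" using ab(5) by blast
    hence "x \<in> V'" using ab(3) by (subst V'_iff) auto
    hence "{a, b, x} \<subseteq> V'" using aV' by simp
    hence "card {a, b, x} \<le> card V'" using fV by (intro card_mono) (simp_all add: V'_def)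
    moreover have "a \<noteq> b" "x \<noteq> a" "x \<noteq> b" using x(2) ab(3) by auto
    ultimately show ?thesis by simp
  qed
  ultimately have IH: "dissected V' (subpieces n V' T')"
    using Suc e by (intro Suc.hyps(1)) (auto simp: T'_def V'_def)
  have low: "V \<inter> {a..b} = insert a (insert b A)" using ab by (auto simp: A_def)
  have high: "V \<inter> ({..a} \<union> {b..<n}) = V'" using Suc.prems(3) V'_iff by auto
  \<comment> \<open>The outer side of \<open>ab\<close> leaves the pieces of the smaller polygon;
    the inner side leaves nothing but the ear.\<close>
  have "subpieces n V T = insert (insert a (insert b A)) (subpieces n V' T')"
  proof (intro equalityI subsetI)
    fix S assume "S \<in> subpieces n V T"
    then obtain h where S: "3 \<le> card S" and h: "\<forall>e\<in>T. h e \<in> sides n e" and Sh: "S = V \<inter> (\<Inter>e\<in>T. h e)"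
      by (auto simp: subpieces_def)
    have "h (a, b) = {a..b} \<or> h (a, b) = {..a} \<union> {b..<n}" using h e by (auto simp: sides_def)
    thus "S \<in> insert (insert a (insert b A)) (subpieces n V' T')"
    proof
      assume "h (a, b) = {..a} \<union> {b..<n}"
      hence "S = V' \<inter> (\<Inter>e\<in>T'. h e)" unfolding Sh T high[symmetric] by auto
      thus ?thesis using S h by (auto simp: subpieces_def T)
    next
      assume hab: "h (a, b) = {a..b}"
      \<comment> \<open>Otherwise the chosen side of \<open>cd\<close> meets \<open>ab\<close> at
        most in its two ends, too few for a piece.\<close>
      have "{a..b} \<subseteq> h (c, d)" if cd: "(c, d) \<in> T" for c d
      proof (rule ccontr)
        assume "\<not> {a..b} \<subseteq> h (c, d)"
        moreover have "h (c, d) = {c..d} \<or> h (c, d) = {..c} \<union> {d..<n}"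
          using h cd by (auto simp: sides_def)
        ultimately have "{a..b} \<inter> h (c, d) \<subseteq> {a, b}"
          using out[OF cd] chord(3)[OF cd] ab(2,3) Suc.prems(3) by fastforce
        hence "S \<subseteq> {a, b}" using hab e cd unfolding Sh by blast
        hence "card S \<le> card {a, b}" by (intro card_mono) auto
        thus False using S ab by auto
      qed
      hence "S = V \<inter> {a..b}" using hab e unfolding Sh by auto
      thus ?thesis using low by simp
    qed
  next
    fix S assume "S \<in> insert (insert a (insert b A)) (subpieces n V' T')"
    thus "S \<in> subpieces n V T"
    proof
      assume S: "S = insert a (insert b A)"
      have "a \<notin> A" "b \<notin> A" "0 < card A" using A by (auto simp: card_gt_0_iff)
      hence "3 \<le> card S" unfolding S using ab(3) A(1) by simp
      \<comment> \<open>For every chord, including \<open>ab\<close> itself, the side that contains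
        the ear.\<close>
      define h where "h = (\<lambda>(c, d). if c \<le> a \<and> b \<le> d then {c..d} else {..c} \<union> {d..<n})"
      have "h e \<in> sides n e" for e by (auto simp: h_def sides_def split: prod.splits)
      moreover have "{a..b} \<subseteq> h e" if "e \<in> T" for e
        using that out ab(2,3) chord(3) Suc.prems(3) by (cases e) (fastforce simp: h_def)
      hence "S = V \<inter> (\<Inter>e\<in>T. h e)" using e unfolding S low[symmetric] by (auto simp: h_def)
      ultimately show ?thesis using \<open>3 \<le> card S\<close> unfolding subpieces_def by blast
    next
      assume "S \<in> subpieces n V' T'"
      then obtain h where S: "3 \<le> card S" and h: "\<forall>e\<in>T'. h e \<in> sides n e" and Sh: "S = V' \<inter> (\<Inter>e\<in>T'. h e)"
        by (auto simp: subpieces_def)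
      define h' where "h' = h((a, b) := {..a} \<union> {b..<n})"
      have "\<forall>e\<in>T. h' e \<in> sides n e" using h by (auto simp: h'_def sides_def T)
      moreover have "S = V \<inter> (\<Inter>e\<in>T. h' e)"
      proof -
        have "(\<Inter>e\<in>T'. h' e) = (\<Inter>e\<in>T'. h e)"
          by (intro INF_cong) (auto simp: h'_def T'_def)
        moreover have "h' (a, b) = {..a} \<union> {b..<n}" by (simp add: h'_def)
        ultimately have "(\<Inter>e\<in>T. h' e) = ({..a} \<union> {b..<n}) \<inter> (\<Inter>e\<in>T'. h e)"
          unfolding T by simp
        thus ?thesis unfolding Sh high[symmetric] by (simp only: Int_assoc)
      qed
      ultimately show ?thesis using S unfolding subpieces_def by blast
    qed
  qed
  moreover have "dissected (V' \<union> A) (insert (insert a (insert b A)) (subpieces n V' T'))"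
    by (rule dissected.glue[OF IH aV' ab(3) gap A])
  ultimately show ?case using VV' by simp
qed

lemma dissected_pieces:
  assumes "3 \<le> n" "noncrossing_diagonals n T"
  shows "dissected {..<n} (pieces n T)"
proof -
  have "T \<subseteq> {..<n} \<times> {..<n}"
    using assms(2) by (force simp: noncrossing_diagonals_def diagonal_def)
  hence "finite T" by (rule finite_subset) simp
  thus ?thesis unfolding pieces_eq_subpieces
    using assms by (intro dissected_subpieces chords_of_noncrossing) auto
qed

section \<open>Walks as lists compared with assignments on arcs\<close>

lemma arc_enum:
  assumes "i < n" "j < n" "i \<noteq> j"
  shows "bij_betw (\<lambda>k. (i + 1 + k) mod n) {..<(j + n - i - 1) mod n} (arc {..<n} i j)"
proof -
  define L where "L = (j + n - i - 1) mod n"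
  define f where "f k = (i + 1 + k) mod n" for k
  have L: "L = (if i < j then j - i - 1 else j + n - i - 1)"
    using assms by (auto simp: L_def le_mod_geq)
  have f: "f k = (if i + 1 + k < n then i + 1 + k else i + 1 + k - n)" if "k < n" for k
    using that assms(1) by (simp add: f_def le_mod_geq)
  have "L < n" using assms(1) by (simp add: L_def)
  hence lt: "k < n" if "k < L" for k using that by simp
  have "bij_betw f {..<L} (arc {..<n} i j)"
  \<comment> \<open>The inverse subtracts \<open>i + 1\<close>, after adding \<open>n\<close> to
    vertices beyond the wrap-around.\<close>
  proof (rule bij_betw_byWitness[where f' = "\<lambda>v. if i < v then v - i - 1 else v + n - i - 1"])
    show "\<forall>k\<in>{..<L}. (if i < f k then f k - i - 1 else f k + n - i - 1) = k"
    proof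
      fix k assume "k \<in> {..<L}"
      hence "k < n" using lt by simp
      thus "(if i < f k then f k - i - 1 else f k + n - i - 1) = k"
        using assms by (auto simp: f)
    qed
    show "\<forall>v\<in>arc {..<n} i j. f (if i < v then v - i - 1 else v + n - i - 1) = v"
      using assms by (auto simp: f_def arc_def)
    show "f ` {..<L} \<subseteq> arc {..<n} i j"
    proof (rule image_subsetI)
      fix k assume "k \<in> {..<L}"
      thus "f k \<in> arc {..<n} i j"
        using assms lt[of k] unfolding L by (auto simp: f arc_def split: if_splits)
    qed
    show "(\<lambda>v. if i < v then v - i - 1 else v + n - i - 1) ` arc {..<n} i j \<subseteq> {..<L}"
      using assms unfolding L by (auto simp: arc_def split: if_splits)
  qed
  thus ?thesis unfolding f_def[abs_def] L_def .
qed

text \<open>Composing with the enumeration of the arc turns assignments into lists, and the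
  multiplicity of a piece in the list is the size of its fibre.\<close>

lemma card_walks:
  assumes ij: "i < n" "j < n" "i \<noteq> j"
  shows "card {w. is_walk n D i j w} = nassign D (arc {..<n} i j)"
proof -
  define L where "L = (j + n - i - 1) mod n"
  define f where "f k = (i + 1 + k) mod n" for k
  let ?X = "arc {..<n} i j"
  have bij: "bij_betw f {..<L} ?X" using arc_enum[OF ij] by (simp add: L_def f_def[abs_def])
  define g where "g = the_inv_into {..<L} f"
  have fX: "f k \<in> ?X" and gf: "g (f k) = k" if "k < L" for k
    using bij that the_inv_into_f_f[of f "{..<L}" k] by (auto simp: g_def bij_betw_def)
  have gX: "g v < L" and fg: "f (g v) = v" if "v \<in> ?X" for v
    using bij that the_inv_into_into[of f "{..<L}" v "{..<L}"] f_the_inv_into_f[of f "{..<L}" v]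
    by (auto simp: g_def bij_betw_def)
  have count: "count_list (map (\<lambda>k. p (f k)) [0..<L]) \<alpha> = card {v \<in> ?X. p v = \<alpha>}"
    for p :: "nat \<Rightarrow> nat set" and \<alpha>
  proof -
    have "count_list (map (\<lambda>k. p (f k)) [0..<L]) \<alpha> = card {k. k < L \<and> p (f k) = \<alpha>}"
      by (simp add: count_list_eq_length_filter length_filter_conv_card cong: conj_cong) (rule arg_cong[of _ _ card], auto)
    also have "\<dots> = card {v \<in> ?X. p v = \<alpha>}"
      by (rule bij_betw_same_card[of f], rule bij_betw_byWitness[where f' = g])
        (use fX gf gX fg in auto)
    finally show ?thesis .
  qed
  have walk: "is_walk n D i j w \<longleftrightarrow> length w = L \<and> set w \<subseteq> D \<and> (\<forall>k<L. f k \<in> w ! k) \<and>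
      (\<forall>\<alpha>\<in>D. count_list w \<alpha> \<le> card \<alpha> - 2)" for w
    using ij by (auto simp: is_walk_def L_def f_def)
  have list: "map (\<lambda>k. restrict (\<lambda>v. w ! g v) ?X (f k)) [0..<L] = w" if "length w = L" for w :: "nat set list"
    using that fX gf by (intro nth_equalityI) auto
  have "bij_betw (\<lambda>p. map (\<lambda>k. p (f k)) [0..<L]) (assignments D ?X) {w. is_walk n D i j w}"
  proof (rule bij_betw_byWitness[where f' = "\<lambda>w. restrict (\<lambda>v. w ! g v) ?X"])
    show "\<forall>p\<in>assignments D ?X. restrict (\<lambda>v. map (\<lambda>k. p (f k)) [0..<L] ! g v) ?X = p"
      using gX fg by (auto simp: assignments_def PiE_def extensional_def fun_eq_iff)
    show "\<forall>w\<in>{w. is_walk n D i j w}. map (\<lambda>k. restrict (\<lambda>v. w ! g v) ?X (f k)) [0..<L] = w"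
      using list by (auto simp: walk)
    show "(\<lambda>p. map (\<lambda>k. p (f k)) [0..<L]) ` assignments D ?X \<subseteq> {w. is_walk n D i j w}"
    proof (rule image_subsetI)
      fix p assume p: "p \<in> assignments D ?X"
      hence "set (map (\<lambda>k. p (f k)) [0..<L]) \<subseteq> D"
        using fX by (auto simp: assignments_def dest!: PiE_mem)
      moreover have "\<forall>k<L. f k \<in> map (\<lambda>k. p (f k)) [0..<L] ! k"
        using fX p by (simp add: assignments_def)
      moreover have "\<forall>\<alpha>\<in>D. count_list (map (\<lambda>k. p (f k)) [0..<L]) \<alpha> \<le> card \<alpha> - 2"
        unfolding count using p by (simp add: assignments_def)
      ultimately show "map (\<lambda>k. p (f k)) [0..<L] \<in> {w. is_walk n D i j w}"
        unfolding walk by simp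
    qed
    show "(\<lambda>w. restrict (\<lambda>v. w ! g v) ?X) ` {w. is_walk n D i j w} \<subseteq> assignments D ?X"
    proof (rule image_subsetI)
      fix w assume "w \<in> {w. is_walk n D i j w}"
      hence w: "length w = L" "set w \<subseteq> D" "\<forall>k<L. f k \<in> w ! k" "\<forall>\<alpha>\<in>D. count_list w \<alpha> \<le> card \<alpha> - 2"
        by (auto simp: walk)
      have "restrict (\<lambda>v. w ! g v) ?X \<in> ?X \<rightarrow>\<^sub>E D"
        using gX w(1,2) nth_mem[of _ w] by auto
      moreover have "\<forall>v\<in>?X. v \<in> restrict (\<lambda>v. w ! g v) ?X v" using w(3) gX fg by fastforce
      moreover have "\<forall>\<alpha>\<in>D. card {v \<in> ?X. restrict (\<lambda>v. w ! g v) ?X v = \<alpha>} \<le> card \<alpha> - 2"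
        using w(4) count[of "restrict (\<lambda>v. w ! g v) ?X"] list[OF w(1)] by simp
      ultimately show "restrict (\<lambda>v. w ! g v) ?X \<in> assignments D ?X" by (simp add: assignments_def)
    qed
  qed
  thus ?thesis unfolding nassign_def by (rule bij_betw_same_card[symmetric])
qed

section \<open>Unimodular equivalence\<close>

text \<open>Only the product of the two determinants is recorded: it is what determines \<open>det A\<close> from \<open>det B\<close>.\<close>

definition unimodular_equiv :: "nat \<Rightarrow> int \<Rightarrow> int mat \<Rightarrow> int mat \<Rightarrow> bool" where
  "unimodular_equiv n s A B \<longleftrightarrow> (\<exists>U\<in>carrier_mat n n. \<exists>V\<in>carrier_mat n n.
     det U * det V = s \<and> U * A * V = B)"

lemma unimodular_equivI:
  "U \<in> carrier_mat n n \<Longrightarrow> V \<in> carrier_mat n n \<Longrightarrow> det U * det V = s \<Longrightarrow> U * A * V = B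
    \<Longrightarrow> unimodular_equiv n s A B"
  unfolding unimodular_equiv_def by blast

lemma unimodular_equiv_trans:
  assumes "A \<in> carrier_mat n n" "unimodular_equiv n s A B" "unimodular_equiv n t B C"
  shows "unimodular_equiv n (s * t) A C"
proof -
  obtain U V where UV: "U \<in> carrier_mat n n" "V \<in> carrier_mat n n" "det U * det V = s" "U * A * V = B"
    using assms unfolding unimodular_equiv_def by blast
  obtain U' V' where UV': "U' \<in> carrier_mat n n" "V' \<in> carrier_mat n n" "det U' * det V' = t" "U' * B * V' = C"
    using assms unfolding unimodular_equiv_def by blast
  have "(U' * U) * A * (V * V') = U' * (U * A * V) * V'"
    using UV(1,2) UV'(1,2) assms(1) by (simp add: assoc_mult_mat[of _ n n _ n _ n])
  moreover have "det (U' * U) * det (V * V') = s * t"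
    using UV UV' by (simp add: det_mult ac_simps)
  ultimately show ?thesis
    using UV UV' by (intro unimodular_equivI[of "U' * U" _ "V * V'"]) auto
qed

text \<open>Block-diagonal multipliers let the old polygon and the ear be reduced
  separately.\<close>

lemma unimodular_equiv_block:
  assumes A: "A \<in> carrier_mat n n" "A' \<in> carrier_mat k k"
    and eq: "unimodular_equiv n s A B" "unimodular_equiv k t A' B'"
  shows "unimodular_equiv (n + k) (s * t)
    (four_block_mat A (0\<^sub>m n k) (0\<^sub>m k n) A') (four_block_mat B (0\<^sub>m n k) (0\<^sub>m k n) B')"
proof -
  obtain U V where UV: "U \<in> carrier_mat n n" "V \<in> carrier_mat n n" "det U * det V = s" "U * A * V = B"
    using eq unfolding unimodular_equiv_def by blast
  obtain U' V' where UV': "U' \<in> carrier_mat k k" "V' \<in> carrier_mat k k" "det U' * det V' = t" "U' * A' * V' = B'"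
    using eq unfolding unimodular_equiv_def by blast
  let ?d = "\<lambda>X Y. four_block_mat X (0\<^sub>m n k) (0\<^sub>m k n) Y :: int mat"
  have mult: "?d X Y * ?d X' Y' = ?d (X * X') (Y * Y')"
    if "X \<in> carrier_mat n n" "X' \<in> carrier_mat n n" "Y \<in> carrier_mat k k" "Y' \<in> carrier_mat k k" for X X' Y Y'
    using that by (subst mult_four_block_mat[where ?nr1.0 = n and ?n1.0 = n and ?n2.0 = k and ?nr2.0 = k and ?nc1.0 = n and ?nc2.0 = k]) auto
  have "?d U U' * ?d A A' * ?d V V' = ?d B B'"
    using UV UV' A by (simp add: mult)
  moreover have "det (?d U U') * det (?d V V') = s * t"
    unfolding UV(3)[symmetric] UV'(3)[symmetric]
    using UV(1,2) UV'(1,2) by (simp add: det_four_block_mat_upper_right_zero[of _ n _ k] ac_simps)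
  ultimately show ?thesis
    using UV UV' by (intro unimodular_equivI[of "?d U U'" _ "?d V V'"]) auto
qed

text \<open>The determinant is 1 or -1, so multiplying the adjugate by it gives an integral
  inverse.\<close>

lemma invertible_mat_int:
  fixes A :: "int mat"
  assumes A: "A \<in> carrier_mat n n" and det: "det A dvd 1"
  shows "invertible_mat A"
proof -
  let ?B = "det A \<cdot>\<^sub>m adj_mat A"
  have s: "det A * det A = 1" using det by (auto simp: zdvd1_eq abs_if split: if_splits)
  note adj = adj_mat[OF A]
  have "A * ?B = 1\<^sub>m n" "?B * A = 1\<^sub>m n"
    using A adj s by (auto simp: mult_smult_distrib[OF A] mult_smult_assoc_mat[OF adj(1) A] intro!: eq_matI)
  thus ?thesis using A adj by (auto simp: invertible_mat_def inverts_mat_def intro!: exI[of _ ?B])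
qed

lemma sum_indicator_mult:
  fixes f :: "nat \<Rightarrow> int"
  assumes "a < n"
  shows "(\<Sum>j = 0..<n. (if j = a then c else 0) * f j) = c * f a"
    "(\<Sum>j = 0..<n. f j * (if j = a then c else 0)) = f a * c"
  using assms by (simp_all add: if_distrib[of "\<lambda>x. x * _"] if_distrib[of "\<lambda>x. _ * x"] sum.delta cong: if_cong)

text \<open>Rows and columns are permuted together: the multipliers are a permutation matrix and its
  transpose, so the sign of the permutation cancels.\<close>

lemma unimodular_equiv_permute:
  fixes A :: "int mat"
  assumes A: "A \<in> carrier_mat n n" and p: "p permutes {..<n}"
  shows "unimodular_equiv n 1 A (mat n n (\<lambda>(i, j). A $$ (p i, p j)))"
proof -
  define P where "P = mat n n (\<lambda>(i, j). if j = p i then 1 else 0 :: int)"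
  have P: "P \<in> carrier_mat n n" by (simp add: P_def)
  have lt: "p i < n" if "i < n" for i using permutes_in_image[OF p, of i] that by simp
  have inj: "p i = p j \<longleftrightarrow> i = j" for i j using permutes_inj[OF p] by (auto dest: injD)
  have PB: "(P * B) $$ (i, j) = B $$ (p i, j)" if "B \<in> carrier_mat n n" "i < n" "j < n" for B i j
    using that lt[of i] by (simp add: P_def scalar_prod_def sum_indicator_mult)
  have BP: "(B * transpose_mat P) $$ (i, j) = B $$ (i, p j)" if "B \<in> carrier_mat n n" "i < n" "j < n" for B i j
    using that lt[of j] by (simp add: P_def scalar_prod_def sum_indicator_mult)
  have "P * transpose_mat P = 1\<^sub>m n"
  proof (rule eq_matI)
    fix i j assume "i < dim_row (1\<^sub>m n :: int mat)" "j < dim_col (1\<^sub>m n :: int mat)"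
    thus "(P * transpose_mat P) $$ (i, j) = 1\<^sub>m n $$ (i, j)"
      using lt by (simp add: BP[OF P] del: index_mult_mat) (auto simp: P_def inj)
  qed (use P in auto)
  hence "det (P * transpose_mat P) = 1" by simp
  hence "det P * det (transpose_mat P) = 1" using P by (simp add: det_mult)
  moreover have "P * A * transpose_mat P = mat n n (\<lambda>(i, j). A $$ (p i, p j))"
  proof (rule eq_matI)
    fix i j assume "i < dim_row (mat n n (\<lambda>(i, j). A $$ (p i, p j)))"
      "j < dim_col (mat n n (\<lambda>(i, j). A $$ (p i, p j)))"
    hence ij: "i < n" "j < n" by auto
    thus "(P * A * transpose_mat P) $$ (i, j) = mat n n (\<lambda>(i, j). A $$ (p i, p j)) $$ (i, j)"
      using BP[of "P * A" i j] PB[of A i "p j"] P A lt by (simp del: index_mult_mat(1))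
  qed (use P A in auto)
  ultimately show ?thesis using P by (intro unimodular_equivI[of P _ "transpose_mat P"]) auto
qed

lemma mult_mat_index:
  fixes f g :: "nat \<times> nat \<Rightarrow> int"
  assumes "i < k" "j < k"
  shows "(mat k k f * mat k k g) $$ (i, j) = (\<Sum>l = 0..<k. f (i, l) * g (l, j))"
  using assms by (simp add: scalar_prod_def)

lemma prod_list_map_upt_const:
  "(\<And>i. i < n \<Longrightarrow> f i = c) \<Longrightarrow> prod_list (map f [0..<n]) = (c :: int) ^ n"
  by (induction n) auto

lemma unimodular_equiv_neg_id_plus_ones:
  assumes k: "k \<ge> 1"
  shows "unimodular_equiv k ((-1) ^ k) (mat k k (\<lambda>(i, j). if i = j then - 2 else - 1))
    (mat k k (\<lambda>(i, j). if i = j then if i = 0 then int k + 1 else 1 else 0))"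
proof -
  let ?Q = "mat k k (\<lambda>(i, j). if i = j then - 2 else - 1 :: int)"
  let ?R = "mat k k (\<lambda>(i, j). if i = j then if i = 0 then int k + 1 else 1 else 0 :: int)"
  \<comment> \<open>\<open>L\<close> negates all rows and then subtracts the first from the others;
    its determinant is the only source of the sign. \<open>V\<close> adds the other columns to the
    first, where \<open>k + 1\<close> appears. \<open>W\<close> clears the rest of the first row.
    The intermediate results are \<open>K\<close> and \<open>H\<close>.\<close>
  define L where "L = mat k k (\<lambda>(i, j). if i = j then - 1 else if j = 0 then 1 else 0 :: int)"
  define V where "V = mat k k (\<lambda>(i, j). if i = j then 1 else if j = 0 then 1 else 0 :: int)"
  define W where "W = mat k k (\<lambda>(i, j). if i = j then 1 else if i = 0 then - 1 else 0 :: int)"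
  have c: "L \<in> carrier_mat k k" "V \<in> carrier_mat k k" "W \<in> carrier_mat k k" "?Q \<in> carrier_mat k k"
    by (auto simp: L_def V_def W_def)
  have dL: "det L = (-1) ^ k"
    using c(1) by (subst det_lower_triangular[of k]) (auto simp: L_def diag_mat_def intro!: prod_list_map_upt_const)
  have dV: "det V = 1"
    using c(2) prod_list_map_upt_const[of k "\<lambda>i. V $$ (i, i)" 1]
    by (subst det_lower_triangular[of k]) (auto simp: V_def diag_mat_def)
  have dW: "det W = 1"
    using c(3) prod_list_map_upt_const[of k "\<lambda>i. W $$ (i, i)" 1]
    by (subst det_upper_triangular[of W k]) (auto simp: W_def diag_mat_def upper_triangular_def)
  define K where "K = mat k k (\<lambda>(i, j). if i = 0 then (if j = 0 then 2 else 1) else if j = 0 then - 1 else if i = j then 1 else 0 :: int)"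
  define H where "H = mat k k (\<lambda>(i, j). if i = 0 then (if j = 0 then int k + 1 else 1) else if i = j then 1 else 0 :: int)"
  have LQ: "L * ?Q = K"
  proof (rule eq_matI)
    fix i j assume "i < dim_row K" "j < dim_col K"
    hence ij: "i < k" "j < k" by (auto simp: K_def)
    \<comment> \<open>A row of \<open>L\<close> is a sum of two indicators; the second is switched
      off for \<open>i = 0\<close>, where both would hit the diagonal.\<close>
    have "(L * ?Q) $$ (i, j) = (\<Sum>l = 0..<k. ((if l = i then - 1 else 0) + (if l = 0 then if i = 0 then 0 else 1 else 0)) * (if l = j then - 2 else - 1))"
      unfolding L_def mult_mat_index[OF ij] by (intro sum.cong) auto
    also have "\<dots> = K $$ (i, j)"
      using ij k by (simp add: distrib_right sum.distrib sum_indicator_mult K_def)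
    finally show "(L * ?Q) $$ (i, j) = K $$ (i, j)" .
  qed (auto simp: L_def K_def)
  have KV: "K * V = H"
  proof (rule eq_matI)
    fix i j assume "i < dim_row H" "j < dim_col H"
    hence ij: "i < k" "j < k" by (auto simp: H_def)
    show "(K * V) $$ (i, j) = H $$ (i, j)"
    proof (cases "j = 0")
      case True
      have "(K * V) $$ (i, j) = (\<Sum>l = 0..<k. K $$ (i, l))"
        unfolding V_def K_def mult_mat_index[OF ij] using ij True by (intro sum.cong) auto
      also have "\<dots> = (\<Sum>l = 0..<k. (if l = i then 1 else 0) * 1 + (if l = 0 then if i = 0 then 0 else - 1 else 0) * 1 + (if i = 0 then 1 else 0))"
        using ij by (intro sum.cong) (auto simp: K_def)
      also have "\<dots> = H $$ (i, j)"
        using ij k True by (simp only: sum.distrib sum_indicator_mult) (auto simp: H_def sum.delta)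
      finally show ?thesis .
    next
      case False
      have "(K * V) $$ (i, j) = (\<Sum>l = 0..<k. K $$ (i, l) * (if l = j then 1 else 0))"
        unfolding V_def K_def mult_mat_index[OF ij] using ij False by (intro sum.cong) auto
      thus ?thesis using ij False by (simp add: sum_indicator_mult) (simp add: K_def H_def)
    qed
  qed (auto simp: V_def K_def H_def)
  have WH: "W * H = ?R"
  proof (rule eq_matI)
    fix i j assume "i < dim_row ?R" "j < dim_col ?R"
    hence ij: "i < k" "j < k" by auto
    show "(W * H) $$ (i, j) = ?R $$ (i, j)"
    proof (cases "i = 0")
      case True
      have "(W * H) $$ (i, j) = (\<Sum>l = 0..<k. (if l = 0 then 1 else 0) * H $$ (l, j) + (if l = j then if j = 0 then 0 else - 1 else 0) * 1)"
        unfolding W_def H_def mult_mat_index[OF ij] using ij True by (intro sum.cong) auto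
      also have "\<dots> = ?R $$ (i, j)"
        using ij k True by (simp only: sum.distrib sum_indicator_mult) (auto simp: H_def)
      finally show ?thesis .
    next
      case False
      have "(W * H) $$ (i, j) = (\<Sum>l = 0..<k. (if l = i then 1 else 0) * H $$ (l, j))"
        unfolding W_def H_def mult_mat_index[OF ij] using ij False by (intro sum.cong) auto
      thus ?thesis using ij False by (simp add: sum_indicator_mult) (simp add: H_def)
    qed
  qed (auto simp: W_def H_def)
  have "(W * L) * ?Q * V = W * (L * ?Q * V)"
    using c by (simp add: assoc_mult_mat[of _ k k _ k _ k])
  hence "(W * L) * ?Q * V = ?R" by (simp add: LQ KV WH)
  moreover have "det (W * L) * det V = (-1) ^ k"
    using c dL dV dW by (simp add: det_mult)
  ultimately show ?thesis using c by (intro unimodular_equivI[of "W * L" _ V]) (auto simp del: assoc_mult_mat)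
qed

text \<open>\<open>L [A, A E\<^sup>T; E A, C] L\<^sup>T = [A, 0; 0, C - E A E\<^sup>T]\<close> for \<open>L = [1, 0; - E, 1]\<close>.\<close>

lemma unimodular_equiv_schur:
  fixes A :: "int mat"
  assumes A: "A \<in> carrier_mat n n" and E: "E \<in> carrier_mat k n" and C: "C \<in> carrier_mat k k"
  shows "unimodular_equiv (n + k) 1
    (four_block_mat A (A * transpose_mat E) (E * A) C)
    (four_block_mat A (0\<^sub>m n k) (0\<^sub>m k n) (C - E * A * transpose_mat E))"
proof -
  let ?E = "transpose_mat E"
  let ?L = "four_block_mat (1\<^sub>m n) (0\<^sub>m n k) (- E) (1\<^sub>m k)"
  let ?R = "four_block_mat (1\<^sub>m n) (- ?E) (0\<^sub>m k n) (1\<^sub>m k)"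
  have Et: "?E \<in> carrier_mat n k" using E by simp
  have prods: "A * ?E \<in> carrier_mat n k" "E * A \<in> carrier_mat k n" "E * A * ?E \<in> carrier_mat k k"
    using A E by auto
  have "?L * four_block_mat A (A * ?E) (E * A) C
    = four_block_mat A (A * ?E) (- E * A + E * A) (- E * (A * ?E) + C)"
    using A E C by (subst mult_four_block_mat[where ?nr1.0 = n and ?n1.0 = n and ?n2.0 = k and ?nr2.0 = k and ?nc1.0 = n and ?nc2.0 = k]) auto
  also have "- E * A + E * A = 0\<^sub>m k n"
    using A E by (simp add: uminus_mult_left_mat) 
  also have "- E * (A * ?E) + C = C - E * A * ?E"
    using A E C by (intro eq_matI) (auto simp: uminus_mult_left_mat assoc_mult_mat[of _ k n _ n _ k])
  finally have "?L * four_block_mat A (A * ?E) (E * A) C * ?R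
    = four_block_mat A (A * ?E) (0\<^sub>m k n) (C - E * A * ?E) * ?R" by simp
  also have "\<dots> = four_block_mat A (A * - ?E + A * ?E) (0\<^sub>m k n) (C - E * A * ?E)"
    using A E C prods by (subst mult_four_block_mat[where ?nr1.0 = n and ?n1.0 = n and ?n2.0 = k and ?nr2.0 = k and ?nc1.0 = n and ?nc2.0 = k]) auto
  also have "A * - ?E + A * ?E = 0\<^sub>m n k"
    using A E by (simp add: uminus_mult_right_mat)
  finally have "?L * four_block_mat A (A * ?E) (E * A) C * ?R
    = four_block_mat A (0\<^sub>m n k) (0\<^sub>m k n) (C - E * A * ?E)" .
  moreover have "det ?L = 1" "det ?R = 1"
    using E by (simp_all add: det_four_block_mat_upper_right_zero[of _ n _ k] det_four_block_mat_lower_left_zero[of _ n _ k])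
  ultimately show ?thesis using E by (intro unimodular_equivI[of ?L _ ?R]) auto
qed

section \<open>The walk matrix\<close>

text \<open>The order of the vertices is a parameter: the new vertices can follow the old ones
  although their labels lie between \<open>a\<close> and \<open>b\<close>.\<close>

definition walk_mat_of :: "nat set \<Rightarrow> nat set set \<Rightarrow> nat list \<Rightarrow> int mat" where
  "walk_mat_of V D xs = mat (length xs) (length xs) (\<lambda>(i, j). int (nassign D (arc V (xs ! i) (xs ! j))))"

lemma walk_mat_of_carrier: "walk_mat_of V D xs \<in> carrier_mat (length xs) (length xs)"
  by (simp add: walk_mat_of_def)

text \<open>With the old vertices listed first, the four blocks are the four cases of old and new
  ends, and the Schur complement step separates them.\<close>

lemma unimodular_equiv_glue:
  assumes "ear V D a b A" and xs: "distinct xs" "set xs = V" and ys: "distinct ys" "set ys = A"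
  shows "unimodular_equiv (length xs + length ys) 1
    (walk_mat_of (V \<union> A) (insert (insert a (insert b A)) D) (xs @ ys))
    (four_block_mat (walk_mat_of V D xs) (0\<^sub>m (length xs) (length ys)) (0\<^sub>m (length ys) (length xs))
      (mat (length ys) (length ys) (\<lambda>(i, j). if i = j then - 2 else - 1)))"
proof -
  interpret ear V D a b A by fact
  let ?D = "insert (insert a (insert b A)) D"
  let ?n = "length xs" and ?k = "length ys"
  let ?M = "walk_mat_of V D xs"
  obtain p q where p: "p < ?n" "xs ! p = a" and q: "q < ?n" "xs ! q = b"
    using xs aV bV by (metis in_set_conv_nth)
  have M: "?M \<in> carrier_mat ?n ?n" by (rule walk_mat_of_carrier)
  have M_nth: "?M $$ (i, j) = int (nassign D (arc V (xs ! i) (xs ! j)))" if "i < ?n" "j < ?n" for i j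
    using that by (simp add: walk_mat_of_def)
  \<comment> \<open>Multiplying by \<open>E\<close> adds the rows at the positions \<open>p\<close>
    of \<open>a\<close> and \<open>q\<close> of \<open>b\<close>, as the mixed counts
    require.\<close>
  define E where "E = mat ?k ?n (\<lambda>(i, j). (if j = p then 1 else 0) + (if j = q then 1 else 0 :: int))"
  define C where "C = mat ?k ?k (\<lambda>(i, j). if i = j then 0 else 1 :: int)"
  have E: "E \<in> carrier_mat ?k ?n" and C: "C \<in> carrier_mat ?k ?k" by (auto simp: E_def C_def)
  have EB: "(E * B) $$ (i, j) = B $$ (p, j) + B $$ (q, j)"
    if "B \<in> carrier_mat ?n r" "i < ?k" "j < r" for B :: "int mat" and r i j
    using that p(1) q(1)
    by (simp add: E_def scalar_prod_def distrib_right sum.distrib sum_indicator_mult)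
  have BE: "(B * transpose_mat E) $$ (i, j) = B $$ (i, p) + B $$ (i, q)"
    if "B \<in> carrier_mat r ?n" "i < r" "j < ?k" for B :: "int mat" and r i j
    using that p(1) q(1)
    by (simp add: E_def scalar_prod_def distrib_left sum.distrib sum_indicator_mult)
  have EM: "E * ?M \<in> carrier_mat ?k ?n" using E M by simp
  have "walk_mat_of (V \<union> A) ?D (xs @ ys) = four_block_mat ?M (?M * transpose_mat E) (E * ?M) C"
    (is "?L = ?R")
  proof (rule eq_matI)
    fix i j assume "i < dim_row ?R" "j < dim_col ?R"
    hence ij: "i < ?n + ?k" "j < ?n + ?k" using M C by auto
    have L: "?L $$ (i, j) = int (nassign ?D (arc (V \<union> A) ((xs @ ys) ! i) ((xs @ ys) ! j)))"
      using ij by (simp add: walk_mat_of_def)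
    have R: "?R $$ (i, j) = (if i < ?n then if j < ?n then ?M $$ (i, j) else (?M * transpose_mat E) $$ (i, j - ?n)
        else if j < ?n then (E * ?M) $$ (i - ?n, j) else C $$ (i - ?n, j - ?n))"
      using ij M C by (subst index_mat_four_block) auto
    have xV: "xs ! l \<in> V" if "l < ?n" for l using xs that by auto
    have yA: "ys ! (l - ?n) \<in> A" if "\<not> l < ?n" "l < ?n + ?k" for l using ys that by auto
    show "?L $$ (i, j) = ?R $$ (i, j)"
    proof (cases "i < ?n"; cases "j < ?n")
      assume "i < ?n" "j < ?n"
      thus ?thesis unfolding L R by (simp add: nth_append M_nth glued_old_old xV)
    next
      assume "i < ?n" "\<not> j < ?n"
      moreover from this have "(?M * transpose_mat E) $$ (i, j - ?n) = ?M $$ (i, p) + ?M $$ (i, q)"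
        using ij by (intro BE[OF M]) auto
      ultimately show ?thesis unfolding L R using ij
        by (simp add: nth_append M_nth p q glued_old_new xV yA)
    next
      assume "\<not> i < ?n" "j < ?n"
      moreover from this have "(E * ?M) $$ (i - ?n, j) = ?M $$ (p, j) + ?M $$ (q, j)"
        using ij by (intro EB[OF M]) auto
      ultimately show ?thesis unfolding L R using ij
        by (simp add: nth_append M_nth p q glued_new_old xV yA)
    next
      assume i: "\<not> i < ?n" and j: "\<not> j < ?n"
      have lt: "i - ?n < ?k" "j - ?n < ?k" using i j ij by auto
      show ?thesis
      proof (cases "i = j")
        case True
        thus ?thesis unfolding L R using i lt nassign_arc_same[OF dissected_glued] by (simp add: C_def)
      next
        case False
        hence "ys ! (i - ?n) \<noteq> ys ! (j - ?n)" "i - ?n \<noteq> j - ?n"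
          using i j lt ys(1) by (auto simp: nth_eq_iff_index_eq)
        thus ?thesis unfolding L R
          using i j lt glued_new_new[OF yA yA _ nassign_arc_gap] ij by (simp add: nth_append C_def)
      qed
    qed
  qed (use M C in \<open>auto simp: walk_mat_of_def\<close>)
  moreover have "C - E * ?M * transpose_mat E = mat ?k ?k (\<lambda>(i, j). if i = j then - 2 else - 1)" (is "_ = ?Q")
  proof (rule eq_matI)
    fix i j assume "i < dim_row ?Q" "j < dim_col ?Q"
    hence ij: "i < ?k" "j < ?k" by auto
    have "(E * ?M * transpose_mat E) $$ (i, j) = (?M $$ (p, p) + ?M $$ (q, p)) + (?M $$ (p, q) + ?M $$ (q, q))"
      using ij p q by (simp add: BE[OF EM] EB[OF M] del: index_mult_mat(1))
    \<comment> \<open>There is one walk each way between the neighbours \<open>a\<close> and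
      \<open>b\<close>, and none from a vertex to itself.\<close>
    also have "\<dots> = 2"
      using p q by (simp add: M_nth nassign_arc_same[OF dis] nassign_arc_gap arc_gap)
    finally show "(C - E * ?M * transpose_mat E) $$ (i, j) = ?Q $$ (i, j)"
      using ij E C EM by (simp add: C_def del: index_mult_mat(1))
  qed (use E C in auto)
  ultimately show ?thesis using unimodular_equiv_schur[OF M E C] by simp
qed

text \<open>The diagonal is tracked only as a multiset and the vertices in the order of gluing; both
  are rearranged afterwards. The sign starts at -1 for two vertices and gains a factor -1 with each
  new vertex.\<close>

lemma smith_form_walk_mat_of:
  assumes "dissected V D"
  shows "\<exists>xs es k. distinct xs \<and> set xs = V \<and>
    mset es = image_mset (\<lambda>\<alpha>. int (card \<alpha>) - 1) (mset_set D) + replicate_mset k 1 \<and>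
    length es = length xs \<and>
    unimodular_equiv (length xs) ((- 1) ^ (length xs + 1)) (walk_mat_of V D xs)
      (mat_diag (length xs) (\<lambda>i. es ! i))"
  using assms
proof (induction rule: dissected.induct)
  case (segment a b)
  let ?M = "walk_mat_of {a, b} {} [a, b]"
  have arc: "arc {a, b} a b = {}" "arc {a, b} b a = {}" "arc {a, b} a a = {b}" "arc {a, b} b b = {a}"
    using segment by (auto simp: arc_def)
  have z: "nassign {} {x} = 0" for x :: nat by (rule nassign_not_covered) simp
  have M: "?M \<in> carrier_mat 2 2" using walk_mat_of_carrier[of "{a, b}" "{}" "[a, b]"] by (simp add: numeral_2_eq_2)
  have "unimodular_equiv 2 (- 1) ?M (mat_diag 2 (\<lambda>i. [1, 1] ! i))"
  \<comment> \<open>The matrix of the segment exchanges two coordinates and is its own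
    inverse.\<close>
  proof (rule unimodular_equivI[of ?M _ "1\<^sub>m 2"])
    show "det ?M * det (1\<^sub>m 2) = - 1"
    proof -
      have "?M = swaprows_mat 2 0 1"
        using M segment
        by (intro eq_matI) (auto simp: walk_mat_of_def swaprows_mat_def arc z less_Suc_eq less_2_cases_iff)
      thus ?thesis by (simp add: det_swaprows_mat)
    qed
    show "?M * ?M * 1\<^sub>m 2 = mat_diag 2 (\<lambda>i. [1, 1] ! i)"
      using M segment by (intro eq_matI)
        (auto simp: walk_mat_of_def arc z scalar_prod_def mat_diag_def less_Suc_eq less_2_cases_iff)
  qed (use M in auto)
  thus ?case using segment
    by (intro exI[of _ "[a, b]"] exI[of _ "[1, 1]"] exI[of _ 2]) (simp add: numeral_2_eq_2)
next
  case (glue V D a b A)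
  interpret ear V D a b A by unfold_locales (use glue in auto)
  let ?D = "insert (insert a (insert b A)) D"
  from glue.IH obtain xs es k where xs: "distinct xs" "set xs = V"
    and es: "mset es = image_mset (\<lambda>\<alpha>. int (card \<alpha>) - 1) (mset_set D) + replicate_mset k 1" "length es = length xs"
    and eq: "unimodular_equiv (length xs) ((- 1) ^ (length xs + 1)) (walk_mat_of V D xs)
      (mat_diag (length xs) (\<lambda>i. es ! i))" by blast
  obtain ys where ys: "distinct ys" "set ys = A" using finite_distinct_list[OF A(1)] by blast
  let ?n = "length xs" and ?l = "length ys"
  have l: "?l = card A" "?l \<ge> 1" using ys A distinct_card[of ys] by (auto simp: Suc_le_eq)
  \<comment> \<open>The ear contributes its degree minus one, \<open>card A + 1\<close>, and
    \<open>card A - 1\<close> ones.\<close>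
  let ?es = "es @ (int ?l + 1) # replicate (?l - 1) 1"
  have "unimodular_equiv (?n + ?l) (1 * ((- 1) ^ (?n + 1) * (- 1) ^ ?l)) (walk_mat_of (V \<union> A) ?D (xs @ ys))
    (four_block_mat (mat_diag ?n (\<lambda>i. es ! i)) (0\<^sub>m ?n ?l) (0\<^sub>m ?l ?n)
      (mat ?l ?l (\<lambda>(i, j). if i = j then if i = 0 then int ?l + 1 else 1 else 0)))"
    by (rule unimodular_equiv_trans[OF _ unimodular_equiv_glue[OF ear_axioms xs ys]
          unimodular_equiv_block[OF walk_mat_of_carrier _ eq unimodular_equiv_neg_id_plus_ones[OF l(2)]]])
      (auto simp: walk_mat_of_def)
  also have "four_block_mat (mat_diag ?n (\<lambda>i. es ! i)) (0\<^sub>m ?n ?l) (0\<^sub>m ?l ?n)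
      (mat ?l ?l (\<lambda>(i, j). if i = j then if i = 0 then int ?l + 1 else 1 else 0)) =
    mat_diag (?n + ?l) (\<lambda>i. ?es ! i)"
    by (rule eq_matI) (auto simp: mat_diag_def nth_append nth_Cons' es)
  also have "1 * ((- 1) ^ (?n + 1) * (- 1) ^ ?l) = (- 1 :: int) ^ (?n + ?l + 1)"
    by (simp add: power_add)
  finally have "unimodular_equiv (length (xs @ ys)) ((- 1) ^ (length (xs @ ys) + 1))
      (walk_mat_of (V \<union> A) ?D (xs @ ys)) (mat_diag (length (xs @ ys)) (\<lambda>i. ?es ! i))"
    by simp
  moreover have "mset ?es = image_mset (\<lambda>\<alpha>. int (card \<alpha>) - 1) (mset_set ?D) + replicate_mset (k + ?l - 1) 1"
  proof -
    have "insert a (insert b A) \<notin> D" using dissected_facts[OF dis] disjoint A by blast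
    moreover have "a \<notin> A" "b \<notin> A" using inside by blast+
    moreover have "replicate_mset (k + ?l - 1) (1 :: int) = replicate_mset k 1 + replicate_mset (?l - 1) 1"
      using l by (simp add: multiset_eq_iff)
    ultimately show ?thesis using dissected_facts[OF dis] es l ab A by simp
  qed
  moreover have "distinct (xs @ ys)" "set (xs @ ys) = V \<union> A" using xs ys disjoint by auto
  moreover have "length ?es = length (xs @ ys)" using es l by simp
  ultimately show ?case by blast
qed

section \<open>Return to the natural order of vertices and pieces\<close>

lemma walk_matrix_eq:
  assumes "dissected {..<n} D"
  shows "walk_matrix n D = mat n n (\<lambda>(i, j). int (nassign D (arc {..<n} i j)))"
proof (rule eq_matI)
  fix i j assume "i < dim_row (mat n n (\<lambda>(i, j). int (nassign D (arc {..<n} i j))))"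
    "j < dim_col (mat n n (\<lambda>(i, j). int (nassign D (arc {..<n} i j))))"
  hence ij: "i < n" "j < n" by auto
  show "walk_matrix n D $$ (i, j) = mat n n (\<lambda>(i, j). int (nassign D (arc {..<n} i j))) $$ (i, j)"
  proof (cases "i = j")
    case True
    thus ?thesis using ij nassign_arc_same[OF assms, of i] by (simp add: walk_matrix_def is_walk_def)
  next
    case False
    thus ?thesis using ij card_walks[OF ij False, of D] by (simp add: walk_matrix_def)
  qed
qed (auto simp: walk_matrix_def)

lemma unimodular_equiv_reorder:
  fixes f :: "'a \<Rightarrow> 'a \<Rightarrow> int"
  assumes "mset xs = mset ys"
  shows "unimodular_equiv (length ys) 1 (mat (length ys) (length ys) (\<lambda>(i, j). f (ys ! i) (ys ! j)))
    (mat (length xs) (length xs) (\<lambda>(i, j). f (xs ! i) (xs ! j)))"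
proof -
  obtain p where p: "p permutes {..<length ys}" "permute_list p ys = xs"
    using mset_eq_permutation[OF assms] .
  have lt: "p i < length ys" if "i < length ys" for i
    using permutes_in_image[OF p(1), of i] that by simp
  have nth: "xs ! i = ys ! p i" if "i < length ys" for i
    using permute_list_nth[OF p(1) that] p(2) by simp
  have len: "length xs = length ys" using p(2) by auto
  have "mat (length xs) (length xs) (\<lambda>(i, j). f (xs ! i) (xs ! j)) =
    mat (length ys) (length ys) (\<lambda>(i, j). mat (length ys) (length ys) (\<lambda>(i, j). f (ys ! i) (ys ! j)) $$ (p i, p j))"
    unfolding len by (rule eq_matI) (simp_all add: nth lt)
  thus ?thesis using unimodular_equiv_permute[OF _ p(1)] by simp
qed

text \<open>Not an instance of \<open>unimodular_equiv_reorder\<close>: diagonal entries may repeat,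
  so whether two positions coincide cannot be read off from the entries.\<close>

lemma unimodular_equiv_mat_diag_reorder:
  assumes "mset xs = mset ys"
  shows "unimodular_equiv (length ys) 1 (mat_diag (length ys) (\<lambda>i. ys ! i)) (mat_diag (length xs) (\<lambda>i. xs ! i))"
proof -
  obtain p where p: "p permutes {..<length ys}" "permute_list p ys = xs"
    using mset_eq_permutation[OF assms] .
  have lt: "p i < length ys" if "i < length ys" for i
    using permutes_in_image[OF p(1), of i] that by simp
  have nth: "xs ! i = ys ! p i" if "i < length ys" for i
    using permute_list_nth[OF p(1) that] p(2) by simp
  have len: "length xs = length ys" using p(2) by auto
  have inj: "p i = p j \<longleftrightarrow> i = j" for i j using permutes_inj[OF p(1)] by (auto dest: injD)
  have "mat_diag (length xs) (\<lambda>i. xs ! i) =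
    mat (length ys) (length ys) (\<lambda>(i, j). mat_diag (length ys) (\<lambda>i. ys ! i) $$ (p i, p j))"
    unfolding len by (rule eq_matI) (simp_all add: nth lt inj mat_diag_def)
  thus ?thesis using unimodular_equiv_permute[OF _ p(1), of "mat_diag (length ys) (\<lambda>i. ys ! i)"] by simp
qed

lemma det_mat_diag: "det (mat_diag n f) = (\<Prod>i<n. f i :: int)"
proof -
  have "det (mat_diag n f) = prod_list (diag_mat (mat_diag n f))"
    by (rule det_upper_triangular[of _ n]) (auto simp: upper_triangular_def mat_diag_def)
  also have "diag_mat (mat_diag n f) = map f [0..<n]"
    by (auto simp: diag_mat_def mat_diag_def)
  finally show ?thesis by (simp add: prod.list_conv_set_nth atLeast0LessThan)
qed

theorem theorem2p3:
  fixes n m :: nat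
    and T :: "(nat \<times> nat) set"
    and \<alpha> :: "nat \<Rightarrow> nat set"
    and d :: "nat \<Rightarrow> nat"
  assumes "n \<ge> 3"
    and "noncrossing_diagonals n T"
    and "bij_betw \<alpha> {1..m} (pieces n T)"
    and "\<And>l. l \<in> {1..m} \<Longrightarrow> d l = card (\<alpha> l)"
  shows "transpose_mat (walk_matrix n (pieces n T)) = walk_matrix n (pieces n T)
    \<and> det (walk_matrix n (pieces n T)) = (-1) ^ (n - 1) * (\<Prod>l = 1..m. int (d l) - 1)
    \<and> (\<exists>U \<in> GL_int n. \<exists>V \<in> GL_int n.
         U * walk_matrix n (pieces n T) * V =
           mat_diag n (\<lambda>i. if i < m then int (d (i + 1)) - 1 else 1))"
proof -
  let ?D = "pieces n T"
  let ?M = "walk_matrix n ?D"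
  let ?f = "\<lambda>i. if i < m then int (d (i + 1)) - 1 else 1"
  have dis: "dissected {..<n} ?D" by (rule dissected_pieces[OF assms(1,2)])
  note M = walk_matrix_eq[OF dis]
  have Mc: "?M \<in> carrier_mat n n" by (simp add: walk_matrix_def)
  have sym: "transpose_mat ?M = ?M"
    unfolding M by (rule eq_matI) (simp_all add: nassign_arc_sym[OF dis])
  obtain xs es k where xs: "distinct xs" "set xs = {..<n}"
    and es: "mset es = image_mset (\<lambda>\<alpha>. int (card \<alpha>) - 1) (mset_set ?D) + replicate_mset k 1" "length es = length xs"
    and eq: "unimodular_equiv (length xs) ((- 1) ^ (length xs + 1)) (walk_mat_of {..<n} ?D xs)
      (mat_diag (length xs) (\<lambda>i. es ! i))"
    using smith_form_walk_mat_of[OF dis] by blast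
  have len: "length xs = n" using distinct_card[OF xs(1)] xs(2) by simp
  have "set xs = set [0..<n]" using xs(2) by (simp add: atLeast0LessThan)
  hence "mset xs = mset [0..<n]" using set_eq_iff_mset_eq_distinct[OF xs(1) distinct_upt] by blast
  from unimodular_equiv_reorder[OF this, of "\<lambda>i j. int (nassign ?D (arc {..<n} i j))"]
  have "unimodular_equiv n 1 (mat n n (\<lambda>(i, j). int (nassign ?D (arc {..<n} ([0..<n] ! i) ([0..<n] ! j)))))
      (walk_mat_of {..<n} ?D xs)"
    unfolding walk_mat_of_def len by simp
  moreover have "mat n n (\<lambda>(i, j). int (nassign ?D (arc {..<n} ([0..<n] ! i) ([0..<n] ! j)))) = ?M"
    unfolding M by (rule eq_matI) auto
  ultimately have eq1: "unimodular_equiv n 1 ?M (walk_mat_of {..<n} ?D xs)" by simp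
  have pieces: "mset_set ?D = image_mset \<alpha> (mset_set {1..m})"
    using assms(3) by (simp add: bij_betw_def image_mset_mset_set)
  \<comment> \<open>Comparing lengths identifies the number of ones as \<open>n - m\<close>.\<close>
  have size: "n = m + k"
    using arg_cong[OF es(1), of size] es(2) len pieces by simp
  have "image_mset (\<lambda>l. int (d l) - 1) (mset_set {1..m}) = image_mset (\<lambda>l. int (card (\<alpha> l)) - 1) (mset_set {1..m})"
    using assms(4) by (intro image_mset_cong) simp
  moreover have "{1..m} = Suc ` {0..<m}" by (simp add: image_Suc_atLeastLessThan atLeastLessThanSuc_atLeastAtMost)
  hence "mset_set {1..m} = image_mset Suc (mset_set {0..<m})" by (simp add: image_mset_mset_set)
  ultimately have d: "image_mset (\<lambda>\<alpha>. int (card \<alpha>) - 1) (mset_set ?D) = image_mset (\<lambda>i. int (d (i + 1)) - 1) (mset_set {0..<m})"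
    unfolding pieces by (simp add: image_mset.compositionality o_def)
  have "map ?f [0..<n] = map (\<lambda>i. int (d (i + 1)) - 1) [0..<m] @ replicate k 1"
    unfolding size by (intro nth_equalityI) (auto simp: nth_append)
  hence "mset (map ?f [0..<n]) = mset es"
    unfolding es(1) d by simp
  from unimodular_equiv_mat_diag_reorder[OF this]
  have "unimodular_equiv n 1 (mat_diag n (\<lambda>i. es ! i)) (mat_diag n (\<lambda>i. map ?f [0..<n] ! i))"
    unfolding es(2) len by simp
  moreover have "mat_diag n (\<lambda>i. map ?f [0..<n] ! i) = mat_diag n ?f"
    by (rule eq_matI) (auto simp: mat_diag_def)
  ultimately have eq2: "unimodular_equiv n 1 (mat_diag n (\<lambda>i. es ! i)) (mat_diag n ?f)" by simp
  \<comment> \<open>Three equivalences in a row: reordering the vertices, the Smith form, and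
    reordering the diagonal. Only the middle one carries a sign.\<close>
  have "unimodular_equiv n (1 * ((- 1) ^ (n + 1) * 1)) ?M (mat_diag n ?f)"
    using unimodular_equiv_trans[OF Mc eq1 unimodular_equiv_trans[OF _ eq[unfolded len] eq2]]
      walk_mat_of_carrier[of "{..<n}" ?D xs] len by simp
  then obtain U V where UV: "U \<in> carrier_mat n n" "V \<in> carrier_mat n n"
    "det U * det V = (- 1) ^ (n + 1)" "U * ?M * V = mat_diag n ?f"
    unfolding unimodular_equiv_def by auto
  have sign: "(- 1) ^ (n + 1) = (- 1 :: int) ^ (n - 1)"
    using assms(1) by (cases n) auto
  have unit: "(- 1 :: int) ^ k * (- 1) ^ k = 1" for k by (simp flip: power_mult_distrib)
  \<comment> \<open>The product is a power of -1, so each determinant is a unit.\<close>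
  have "det U * det V dvd 1"
    by (rule dvdI[of _ _ "(- 1) ^ (n + 1)"]) (simp only: UV(3) unit)
  hence "det U dvd 1" "det V dvd 1" by (rule dvd_mult_left, rule dvd_mult_right)
  hence GL: "U \<in> GL_int n" "V \<in> GL_int n"
    using UV(1,2) invertible_mat_int unfolding GL_int_def by auto
  have "det U * det ?M * det V = (\<Prod>i<n. ?f i)"
    using arg_cong[OF UV(4), of det] UV(1,2) Mc by (simp add: det_mult det_mat_diag)
  also have "\<dots> = (\<Prod>i<m. int (d (i + 1)) - 1)"
    unfolding size by (rule prod.mono_neutral_cong_right) auto
  also have "\<dots> = (\<Prod>l = 1..m. int (d l) - 1)"
    by (rule prod.reindex_bij_witness[of _ "\<lambda>l. l - 1" "\<lambda>i. i + 1"]) auto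
  finally have "(det U * det V) * det ?M = (\<Prod>l = 1..m. int (d l) - 1)" by (simp add: ac_simps)
  \<comment> \<open>The sign is its own inverse, so multiplying by it once more isolates the
    determinant.\<close>
  hence "(- 1) ^ (n - 1) * ((- 1) ^ (n - 1) * det ?M) = (- 1) ^ (n - 1) * (\<Prod>l = 1..m. int (d l) - 1)"
    by (simp only: UV(3) sign)
  hence "det ?M = (- 1) ^ (n - 1) * (\<Prod>l = 1..m. int (d l) - 1)"
    by (simp only: mult.assoc[symmetric] unit mult_1)
  thus ?thesis using sym GL UV(4) by blast
qed

end
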